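(* Let $f$ be an order-preserving injective map on the noncompactly causal symmetric space $\mathrm{SO}_0(1,n)/\mathrm{SO}_0(1,n-1)\simeq\mathcal{H}_n$, in the sense that $f\colon\mathcal{H}_n\to\mathcal{H}_n$ is injective and maps $\{y\in\mathcal{H}_n: y\ge x\}$ onto $\{y\in\mathcal{H}_n: y\ge f(x)\}$ for all $x\in\mathcal{H}_n$ (no continuity or surjectivity is assumed). Then $f$ extends to an element of $\mathrm{O}(1,n)^+$, that is, there is $g\in \mathrm{O}(1,n)^+$ with $f(x)=gx$ for all $x\in\mathcal{H}_n$.
   Context: The space $\mathrm{SO}_0(1,n)/\mathrm{SO}_0(1,n-1)$ is identified with the one-sheeted hyperboloid $$\mathcal{H}_n=\{x=(x_0,x_1,\dots,x_n)\in\mathbb{R}^{n+1}: -x_0^2+x_1^2+\dots+x_n^2=1\},$$ with the partial order $$y\ge x\iff \bigl(y_0\ge x_0\ \text{ and }\ -x_0y_0+x_1y_1+\dots+x_ny_n\ge 1\bigr).$$ $\mathrm{O}(1,n)^+$ is the group of linear maps of $\mathbb{R}^{n+1}$ that preserve the quadratic form $-x_0^2+x_1^2+\dots+x_n^2$ and map the forward cone $\{x: x_0^2>x_1^2+\dots+x_n^2,\ x_0>0\}$ to itself.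
   Formalization: The formal theorem assumes n ≥ 3; the claim is false for n = 1 (each branch is a chain, so nonlinear increasing bijections are allowed) and for n = 2 (the order is reverse inclusion of circle arcs, preserved by every non-Möbius circle homeomorphism). *)

theory Defs
  imports "HOL-Analysis.Analysis"
begin

(* Points (x_0, x_1, ..., x_n) are pairs (x_0, (x_1, ..., x_n)) of type real \<times> (real ^ 'n),
   with n = CARD('n).  Order preserving maps are rigid only for n \<ge> 3: for n = 1 each branch of
   the hyperboloid is a chain, and for n = 2 the order is reverse inclusion of the arcs
   {u. norm u = 1 \<and> lorentz x (1, u) > 0}, which every orientation preserving homeomorphism of the
   circle respects. *)

definition lorentz :: "real \<times> (real ^ 'n) \<Rightarrow> real \<times> (real ^ 'n) \<Rightarrow> real" where
  "lorentz x y = - (fst x * fst y) + (\<Sum>i\<in>UNIV. snd x $ i * snd y $ i)"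

definition hyperboloid :: "(real \<times> (real ^ 'n)) set" where
  "hyperboloid = {x. lorentz x x = 1}"

definition causal_le :: "real \<times> (real ^ 'n) \<Rightarrow> real \<times> (real ^ 'n) \<Rightarrow> bool" where
  "causal_le x y \<longleftrightarrow> fst y \<ge> fst x \<and> lorentz x y \<ge> 1"

definition future :: "real \<times> (real ^ 'n) \<Rightarrow> (real \<times> (real ^ 'n)) set" where
  "future x = {y \<in> hyperboloid. causal_le x y}"

definition forward_cone :: "(real \<times> (real ^ 'n)) set" where
  "forward_cone = {x. (fst x)\<^sup>2 > (\<Sum>i\<in>UNIV. (snd x $ i)\<^sup>2) \<and> fst x > 0}"

(* Bijectivity of g is automatic, since the form is nondegenerate. *)
definition orthochronous_group :: "(real \<times> (real ^ 'n) \<Rightarrow> real \<times> (real ^ 'n)) set" where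
  "orthochronous_group =
    {g. linear g \<and> (\<forall>x. lorentz (g x) (g x) = lorentz x x) \<and> g ` forward_cone = forward_cone}"

end

theory Submission imports Defs begin

text \<open>The order is the restriction of the causal order of Minkowski space \<open>\<real>\<^sup>1\<^sup>,\<^sup>n\<close>, and \<open>f\<close> is an order
  embedding whose image is an up-set. Lightlike pairs are those whose order interval is a chain, so \<open>f\<close>
  maps each null line \<open>y + \<real> v\<close> into a null line \<open>f y + \<real> v'\<close>. Whether \<open>lorentz x v > 0\<close> holds
  can be read off the order (\<open>x\<close> lies below the far end of the line, but not on it), so the
  direction \<open>v'\<close> depends on \<open>v\<close> alone. Since \<open>- y \<le> x\<close> means that \<open>x\<close> and \<open>y\<close> have no
  common upper bound, \<open>f\<close> also respects the relation \<open>lorentz x y = - 1\<close> and commutes with \<open>x \<mapsto> - x\<close>.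
  Hence the two parameters at which a point \<open>x\<close> is null related, directly or antipodally, to a
  line of direction \<open>v\<close> are carried to the corresponding parameters for \<open>f x\<close>. Their distance depends on
  \<open>lorentz x v\<close> only, and this forces \<open>f\<close> to be affine on the null lines and
  \<open>lorentz (f x) v'\<close> to be a constant multiple of \<open>lorentz x v\<close>. As the null vectors span,
  \<open>f\<close> is linear.\<close>

section \<open>The Lorentz form and its causal and null cones\<close>

lemma lorentz_eq: "lorentz x y = snd x \<bullet> snd y - fst x * fst y"
  by (simp add: lorentz_def inner_vec_def)

lemma lorentz_commute: "lorentz x y = lorentz y x"
  by (simp add: lorentz_eq inner_commute)

lemma lorentz_simps [simp]:
  "lorentz (x + y) z = lorentz x z + lorentz y z"
  "lorentz z (x + y) = lorentz z x + lorentz z y"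
  "lorentz (x - y) z = lorentz x z - lorentz y z"
  "lorentz z (x - y) = lorentz z x - lorentz z y"
  "lorentz (- x) z = - lorentz x z"
  "lorentz z (- x) = - lorentz z x"
  "lorentz (c *\<^sub>R x) z = c * lorentz x z"
  "lorentz z (c *\<^sub>R x) = c * lorentz z x"
  "lorentz 0 z = 0"
  "lorentz z 0 = 0"
  by (simp_all add: lorentz_eq inner_simps algebra_simps)

definition causal_cone :: "(real \<times> (real ^ 'n)) set" where
  "causal_cone = {w. norm (snd w) \<le> fst w}"

definition null_cone :: "(real \<times> (real ^ 'n)) set" where
  "null_cone = {v. norm (snd v) = fst v \<and> 0 < fst v}"

lemma null_cone_causal: "v \<in> null_cone \<Longrightarrow> v \<in> causal_cone"
  by (simp add: null_cone_def causal_cone_def)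

lemma null_cone_nonzero: "v \<in> null_cone \<Longrightarrow> v \<noteq> 0"
  by (auto simp: null_cone_def)

lemma lorentz_self: "lorentz w w = (norm (snd w))\<^sup>2 - (fst w)\<^sup>2"
  by (simp add: lorentz_eq power2_norm_eq_inner) (simp add: power2_eq_square)

lemma null_cone_lorentz: "v \<in> null_cone \<Longrightarrow> lorentz v v = 0"
  by (simp add: null_cone_def lorentz_self)

lemma null_cone_iff: "v \<in> null_cone \<longleftrightarrow> v \<in> causal_cone \<and> lorentz v v = 0 \<and> v \<noteq> 0"
proof
  assume a: "v \<in> causal_cone \<and> lorentz v v = 0 \<and> v \<noteq> 0"
  then have le: "norm (snd v) \<le> fst v" and "(norm (snd v))\<^sup>2 = (fst v)\<^sup>2"
    by (auto simp: causal_cone_def lorentz_self)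
  then have "norm (snd v) = fst v"
    by (metis norm_ge_zero order_trans power2_eq_imp_eq)
  moreover from this have "fst v \<noteq> 0"
    using a by (auto simp: prod_eq_iff)
  moreover have "0 \<le> fst v"
    using le norm_ge_zero order_trans by blast
  ultimately show "v \<in> null_cone"
    by (simp add: null_cone_def)
qed (auto simp: null_cone_causal null_cone_lorentz null_cone_nonzero)

lemma causal_cone_add: "v \<in> causal_cone \<Longrightarrow> w \<in> causal_cone \<Longrightarrow> v + w \<in> causal_cone"
  unfolding causal_cone_def using norm_triangle_ineq[of "snd v" "snd w"] by auto

lemma causal_cone_scaleR: "v \<in> causal_cone \<Longrightarrow> 0 \<le> c \<Longrightarrow> c *\<^sub>R v \<in> causal_cone"
  by (simp add: causal_cone_def mult_left_mono)

lemma scaleR_causal_imp_nonneg: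
  assumes "v \<in> null_cone" "c *\<^sub>R v \<in> causal_cone"
  shows "0 \<le> c"
proof -
  have "\<bar>c\<bar> * fst v \<le> c * fst v" "0 < fst v"
    using assms by (simp_all add: null_cone_def causal_cone_def)
  then show ?thesis
    using mult_le_cancel_right_pos by fastforce
qed

lemma causal_cone_lorentz: "w \<in> causal_cone \<Longrightarrow> lorentz w w \<le> 0"
  by (simp add: causal_cone_def lorentz_self power_mono)

lemma lorentz_nonpos_cases:
  assumes "lorentz w w \<le> 0"
  shows "w \<in> causal_cone \<or> - w \<in> causal_cone"
proof -
  have "norm (snd w) \<le> \<bar>fst w\<bar>"
    using assms by (simp add: lorentz_self abs_le_square_iff[symmetric])
  then show ?thesis
    by (auto simp: causal_cone_def abs_if split: if_splits)
qed

lemma lorentz_causal_nonpos: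
  assumes "v \<in> causal_cone" "w \<in> causal_cone"
  shows "lorentz v w \<le> 0"
proof -
  have "snd v \<bullet> snd w \<le> norm (snd v) * norm (snd w)"
    by (rule norm_cauchy_schwarz)
  also have "\<dots> \<le> fst v * fst w"
    using assms order_trans[OF norm_ge_zero[of "snd v"]] unfolding causal_cone_def
    by (intro mult_mono) auto
  finally show ?thesis
    by (simp add: lorentz_eq)
qed

text \<open>Orthogonality forces equality in the Cauchy-Schwarz inequality for the spatial parts,
  which are then proportional with the same factor as the time parts.\<close>

lemma null_causal_orthogonal:
  assumes v: "v \<in> null_cone" and w: "w \<in> causal_cone" and vw: "lorentz v w = 0"
  obtains k where "0 \<le> k" "w = k *\<^sub>R v"
proof -
  have v': "norm (snd v) = fst v" "0 < fst v" and w': "norm (snd w) \<le> fst w"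
    using v w by (auto simp: null_cone_def causal_cone_def)
  have eq: "snd v \<bullet> snd w = fst v * fst w"
    using vw by (simp add: lorentz_eq)
  have "fst v * fst w \<le> fst v * norm (snd w)"
    using norm_cauchy_schwarz[of "snd v" "snd w"] v' eq by simp
  then have nw: "norm (snd w) = fst w"
    using v' w' by simp
  then have "snd v \<bullet> snd w = norm (snd v) * norm (snd w)"
    using eq v' by simp
  then have "fst v *\<^sub>R snd w = fst w *\<^sub>R snd v"
    using norm_cauchy_schwarz_eq[of "snd v" "snd w"] v' nw by simp
  then have "inverse (fst v) *\<^sub>R fst v *\<^sub>R snd w = inverse (fst v) *\<^sub>R fst w *\<^sub>R snd v"
    by simp
  then have "snd w = (fst w / fst v) *\<^sub>R snd v"
    using v' by (simp add: divide_inverse mult.commute)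
  then have "w = (fst w / fst v) *\<^sub>R v"
    using v' by (simp add: prod_eq_iff)
  moreover have "0 \<le> fst w / fst v"
    using v' nw by (metis divide_nonneg_pos norm_ge_zero)
  ultimately show thesis
    using that by blast
qed

lemma null_orthogonal:
  assumes v: "v \<in> null_cone" and vw: "lorentz v w = 0" and ww: "lorentz w w \<le> 0"
  obtains k where "w = k *\<^sub>R v"
  using lorentz_nonpos_cases[OF ww]
proof
  assume "w \<in> causal_cone"
  then show thesis
    using null_causal_orthogonal[OF v _ vw] that by metis
next
  assume "- w \<in> causal_cone"
  then obtain k where "- w = k *\<^sub>R v"
    using null_causal_orthogonal[OF v, of "- w"] vw by auto
  then have "w = (- k) *\<^sub>R v"
    by (metis minus_minus scaleR_minus_left)
  then show thesis
    using that by blast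
qed

text \<open>A time-orientation test: if \<open>- w\<close> were causal, its pairing with
  \<open>v\<close> would be nonpositive, against \<open>lorentz v w < 0\<close>.\<close>

lemma causal_coneI:
  assumes "v \<in> causal_cone" "lorentz w w \<le> 0" "lorentz v w < 0"
  shows "w \<in> causal_cone"
  using lorentz_nonpos_cases[OF assms(2)] lorentz_causal_nonpos[OF assms(1), of "- w"] assms(3)
  by auto

lemma causal_cone_antisym: "v \<in> causal_cone \<Longrightarrow> - v \<in> causal_cone \<Longrightarrow> v = 0"
proof -
  assume "v \<in> causal_cone" "- v \<in> causal_cone"
  then have "norm (snd v) \<le> fst v" "norm (snd v) \<le> - fst v"
    by (auto simp: causal_cone_def)
  then have "norm (snd v) = 0" "fst v = 0"
    using norm_ge_zero[of "snd v"] by linarith+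
  then show "v = 0" by (simp add: prod_eq_iff)
qed

section \<open>The hyperboloid and its causal order\<close>

lemma hyperboloid_iff: "x \<in> hyperboloid \<longleftrightarrow> lorentz x x = 1"
  by (simp add: hyperboloid_def)

lemma hyperboloid_uminus: "x \<in> hyperboloid \<Longrightarrow> - x \<in> hyperboloid"
  by (simp add: hyperboloid_iff)

lemma lorentz_diff_self:
  assumes "x \<in> hyperboloid" "y \<in> hyperboloid"
  shows "lorentz (y - x) (y - x) = 2 - 2 * lorentz x y"
  using assms by (simp add: hyperboloid_iff lorentz_commute[of y x])

lemma lorentz_add_self:
  assumes "x \<in> hyperboloid" "y \<in> hyperboloid"
  shows "lorentz (x + y) (x + y) = 2 + 2 * lorentz x y"
  using assms by (simp add: hyperboloid_iff lorentz_commute[of y x])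

lemma causal_le_iff:
  assumes "x \<in> hyperboloid" "y \<in> hyperboloid"
  shows "causal_le x y \<longleftrightarrow> y - x \<in> causal_cone"
proof
  assume a: "causal_le x y"
  then have "lorentz (y - x) (y - x) \<le> 0"
    using lorentz_diff_self[OF assms] by (simp add: causal_le_def)
  then show "y - x \<in> causal_cone"
    using a by (auto simp: causal_le_def causal_cone_def lorentz_self abs_le_square_iff[symmetric])
next
  assume a: "y - x \<in> causal_cone"
  then have "0 \<le> fst (y - x)"
    unfolding causal_cone_def using order_trans[OF norm_ge_zero] by blast
  then show "causal_le x y"
    using causal_cone_lorentz[OF a] unfolding lorentz_diff_self[OF assms] causal_le_def by simp
qed

lemma future_iff:
  assumes "x \<in> hyperboloid"
  shows "y \<in> future x \<longleftrightarrow> y \<in> hyperboloid \<and> y - x \<in> causal_cone"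
  unfolding future_def using causal_le_iff[OF assms] by blast

lemma causal_hyperboloid_ge:
  assumes "x \<in> hyperboloid" "y \<in> hyperboloid" "y - x \<in> causal_cone"
  shows "1 \<le> lorentz x y"
  using causal_cone_lorentz[OF assms(3)] lorentz_diff_self[OF assms(1,2)] by simp

text \<open>The order test for constructed points: pairing with a causal \<open>v\<close> settles
  the time orientation, so time coordinates need not be compared.\<close>

lemma hyperboloid_causal_diffI:
  assumes "x \<in> hyperboloid" "y \<in> hyperboloid" "1 \<le> lorentz x y"
    and "v \<in> causal_cone" "lorentz v x > lorentz v y"
  shows "y - x \<in> causal_cone"
  by (rule causal_coneI[OF assms(4)]) (use lorentz_diff_self[OF assms(1,2)] assms in auto)

lemma null_line_hyperboloid:
  assumes "y \<in> hyperboloid" "v \<in> null_cone" "lorentz y v = 0"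
  shows "y + t *\<^sub>R v \<in> hyperboloid"
  using assms null_cone_lorentz[of v] by (simp add: hyperboloid_iff lorentz_commute[of v y])

section \<open>Order intervals of timelike and lightlike pairs\<close>

lemma exists_orthogonal_vector:
  fixes a b :: "'a::euclidean_space"
  assumes "DIM('a) \<ge> 3"
  obtains e where "e \<noteq> 0" "e \<bullet> a = 0" "e \<bullet> b = 0"
proof -
  have "dim {a, b} \<le> card {a, b}"
    by (rule dim_le_card') simp
  also have "\<dots> \<le> 2"
    by (simp add: card_insert_if)
  finally have "dim {a, b} < DIM('a)"
    using assms by simp
  then obtain e where "e \<noteq> 0" "\<And>x. x \<in> span {a, b} \<Longrightarrow> orthogonal e x"
    using orthogonal_to_subspace_exists by blast
  then show thesis
    using that by (auto simp: orthogonal_def span_base)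
qed

lemma exists_orthogonal_unit:
  fixes a b :: "'a::euclidean_space"
  assumes "DIM('a) \<ge> 3"
  obtains e where "norm e = 1" "e \<bullet> a = 0" "e \<bullet> b = 0"
proof -
  obtain e where "e \<noteq> 0" "e \<bullet> a = 0" "e \<bullet> b = 0"
    using exists_orthogonal_vector[OF assms] .
  then show thesis
    using that[of "e /\<^sub>R norm e"] by simp
qed

text \<open>By Cauchy-Schwarz a nonzero vector orthogonal to the timelike \<open>w\<close> is
  spacelike, and \<open>x\<close>, \<open>y\<close> leave room for one. The condition
  \<open>orth\<close> holds for \<open>w = y - x\<close>, the case arising from order
  intervals.\<close>

lemma exists_spacelike_orthogonal:
  fixes x y :: "real \<times> (real ^ 'n)"
  assumes card: "CARD('n) \<ge> 3" and w: "w \<in> causal_cone" "lorentz w w < 0"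
    and orth: "\<And>e. lorentz e x = 0 \<Longrightarrow> lorentz e y = 0 \<Longrightarrow> lorentz e w = 0"
  obtains e where "lorentz e e = 1" "lorentz e x = 0" "lorentz e y = 0"
proof -
  \<comment> \<open>Reversing the sign of the time coordinates turns Euclidean orthogonality into
    Lorentz orthogonality.\<close>
  obtain e :: "real \<times> (real ^ 'n)" where e: "e \<noteq> 0" "e \<bullet> (- fst x, snd x) = 0" "e \<bullet> (- fst y, snd y) = 0"
  proof (rule exists_orthogonal_vector)
    show "3 \<le> DIM(real \<times> (real ^ 'n))"
      using card by simp
  qed
  then have ex: "lorentz e x = 0" and ey: "lorentz e y = 0"
    by (cases e; simp add: lorentz_eq)+
  have ew: "lorentz w e = 0"
    using orth[OF ex ey] lorentz_commute[of w e] by simp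
  have pos: "lorentz e e > 0"
  proof (rule ccontr)
    assume n: "\<not> lorentz e e > 0"
    have fw: "norm (snd w) < fst w"
    proof (rule power2_less_imp_less)
      show "0 \<le> fst w"
        using w(1) order_trans[OF norm_ge_zero, of "snd w" "fst w"] by (simp add: causal_cone_def)
    qed (use w(2) in \<open>simp add: lorentz_self\<close>)
    have fe: "norm (snd e) \<le> \<bar>fst e\<bar>"
      using n abs_le_square_iff[of "norm (snd e)" "fst e"] by (simp add: lorentz_self)
    have "fst e \<noteq> 0"
      using fe e(1) by (auto simp: prod_eq_iff)
    have "fst w * \<bar>fst e\<bar> = \<bar>snd w \<bullet> snd e\<bar>"
      using ew order.strict_trans1[OF norm_ge_zero fw] by (simp add: lorentz_eq abs_mult)
    also have "\<dots> \<le> norm (snd w) * norm (snd e)"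
      by (rule Cauchy_Schwarz_ineq2)
    also have "\<dots> \<le> norm (snd w) * \<bar>fst e\<bar>"
      by (rule mult_left_mono[OF fe]) simp
    also have "\<dots> < fst w * \<bar>fst e\<bar>"
      using fw \<open>fst e \<noteq> 0\<close> by simp
    finally show False by simp
  qed
  show thesis
  proof (rule that[of "e /\<^sub>R sqrt (lorentz e e)"])
    show "lorentz (e /\<^sub>R sqrt (lorentz e e)) (e /\<^sub>R sqrt (lorentz e e)) = 1"
      using pos by (simp add: field_simps)
  qed (use ex ey in auto)
qed

text \<open>The witnesses lie on the light cones of both \<^term>\<open>x\<close> and \<^term>\<open>y\<close>.\<close>

lemma timelike_interval_not_chain:
  fixes x y :: "real \<times> (real ^ 'n)"
  assumes card: "CARD('n) \<ge> 3" and x: "x \<in> hyperboloid" and y: "y \<in> hyperboloid"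
    and xy: "y - x \<in> causal_cone" and c: "lorentz x y > 1"
  obtains z w where "z \<in> hyperboloid" "w \<in> hyperboloid"
    "z - x \<in> causal_cone" "y - z \<in> causal_cone" "w - x \<in> causal_cone" "y - w \<in> causal_cone"
    "z - w \<notin> causal_cone" "w - z \<notin> causal_cone"
proof -
  let ?c = "lorentz x y"
  have "lorentz (y - x) (y - x) < 0"
    using c lorentz_diff_self[OF x y] by simp
  then obtain e where e: "lorentz e e = 1" "lorentz e x = 0" "lorentz e y = 0"
    using exists_spacelike_orthogonal[OF card xy, of x y] by auto
  have xx: "lorentz x x = 1" "lorentz y y = 1" "lorentz y x = ?c"
    using x y by (auto simp: hyperboloid_iff lorentz_commute)
  have e': "lorentz x e = 0" "lorentz y e = 0"
    using e by (auto simp: lorentz_commute)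
  \<comment> \<open>The point \<open>(1 / (1 + ?c)) *\<^sub>R (x + y)\<close> pairs to 1 with
    \<open>x\<close> and \<open>y\<close> and has Lorentz square \<open>2 / (1 + ?c)\<close>; the
    multiple \<open>s\<close> of \<open>e\<close> supplies the missing
    \<open>(?c - 1) / (1 + ?c)\<close>.\<close>
  define s where "s = sqrt ((?c - 1) / (1 + ?c))"
  have s2: "s * s = (?c - 1) / (1 + ?c)" and s0: "s > 0"
    using c by (auto simp: s_def)
  define z where "z \<sigma> = (1 / (1 + ?c)) *\<^sub>R (x + y) + \<sigma> *\<^sub>R e" for \<sigma>
  have zx: "lorentz x (z \<sigma>) = 1" "lorentz (z \<sigma>) y = 1" "lorentz y (z \<sigma>) = 1" for \<sigma>
    using c by (simp_all add: z_def xx e e' field_simps)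
  have zH: "z \<sigma> \<in> hyperboloid" if "\<sigma> * \<sigma> = (?c - 1) / (1 + ?c)" for \<sigma>
  proof -
    have "lorentz u (z \<sigma>) = (1 / (1 + ?c)) * (lorentz u x + lorentz u y) + \<sigma> * lorentz u e" for u
      by (simp add: z_def)
    from this[of "z \<sigma>"] have "lorentz (z \<sigma>) (z \<sigma>) = 2 / (1 + ?c) + \<sigma> * lorentz (z \<sigma>) e"
      using zx(1)[of \<sigma>] zx(2)[of \<sigma>] by (simp add: lorentz_commute[of "z \<sigma>" x])
    also have "lorentz (z \<sigma>) e = \<sigma>"
      by (simp add: z_def e e')
    also have "2 / (1 + ?c) + \<sigma> * \<sigma> = 2 / (1 + ?c) + (?c - 1) / (1 + ?c)"
      using that by simp
    also have "\<dots> = 1"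
      using c by (simp add: add_divide_distrib[symmetric])
    finally show ?thesis
      by (simp add: hyperboloid_iff)
  qed
  have up: "z \<sigma> - x \<in> causal_cone" if "\<sigma> * \<sigma> = (?c - 1) / (1 + ?c)" for \<sigma>
    by (rule hyperboloid_causal_diffI[OF x zH[OF that] _ xy]) (use c in \<open>simp_all add: zx xx\<close>)
  have down: "y - z \<sigma> \<in> causal_cone" if "\<sigma> * \<sigma> = (?c - 1) / (1 + ?c)" for \<sigma>
    by (rule hyperboloid_causal_diffI[OF zH[OF that] y _ xy]) (use c in \<open>simp_all add: zx xx\<close>)
  have ss: "s * s = (?c - 1) / (1 + ?c)" "(- s) * (- s) = (?c - 1) / (1 + ?c)"
    using s2 by auto
  \<comment> \<open>The two witnesses differ by a nonzero multiple of the spacelike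
    \<open>e\<close>, hence are incomparable.\<close>
  have diff: "z s - z (- s) = (s - - s) *\<^sub>R e" "z (- s) - z s = (- s - s) *\<^sub>R e"
    by (simp_all only: z_def scaleR_left_diff_distrib add_diff_cancel_left)
  have "lorentz ((s - - s) *\<^sub>R e) ((s - - s) *\<^sub>R e) > 0"
    "lorentz ((- s - s) *\<^sub>R e) ((- s - s) *\<^sub>R e) > 0"
    using s0 e by simp_all
  then have "z s - z (- s) \<notin> causal_cone" "z (- s) - z s \<notin> causal_cone"
    unfolding diff using causal_cone_lorentz not_le by blast+
  then show thesis
    using that[OF zH[OF ss(1)] zH[OF ss(2)] up[OF ss(1)] down[OF ss(1)] up[OF ss(2)] down[OF ss(2)]]
    by blast
qed

text \<open>The null vector \<open>y - x\<close> is the sum of the causal vectors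
  \<open>z - x\<close> and \<open>y - z\<close>. Its pairings with both are nonpositive and add up
  to zero, so both vanish and \<open>z - x\<close> is a multiple of it.\<close>

lemma null_interval:
  assumes x: "x \<in> hyperboloid" and y: "y \<in> hyperboloid"
    and c: "lorentz x y = 1" and z: "z - x \<in> causal_cone" "y - z \<in> causal_cone" and ne: "x \<noteq> y"
  obtains k where "z = x + k *\<^sub>R (y - x)"
proof -
  have "y - x \<in> causal_cone"
    using causal_cone_add[OF z] by simp
  moreover have "lorentz (y - x) (y - x) = 0"
    using lorentz_diff_self[OF x y] c by simp
  ultimately have v: "y - x \<in> null_cone"
    using ne by (simp add: null_cone_iff)
  have "lorentz (y - x) (z - x) + lorentz (y - x) (y - z) = 0"
    using \<open>lorentz (y - x) (y - x) = 0\<close> by simp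
  moreover have "lorentz (y - x) (z - x) \<le> 0" "lorentz (y - x) (y - z) \<le> 0"
    using lorentz_causal_nonpos null_cone_causal[OF v] z by blast+
  ultimately have "lorentz (y - x) (z - x) = 0"
    by linarith
  then obtain k where "z - x = k *\<^sub>R (y - x)"
    using null_causal_orthogonal[OF v z(1)] by blast
  then have "z = x + k *\<^sub>R (y - x)"
    by (metis add.commute diff_add_cancel)
  then show thesis by (rule that)
qed

lemma null_interval_chain:
  assumes x: "x \<in> hyperboloid" and y: "y \<in> hyperboloid" and c: "lorentz x y = 1"
    and z: "z - x \<in> causal_cone" "y - z \<in> causal_cone"
    and w: "w - x \<in> causal_cone" "y - w \<in> causal_cone"
  shows "z - w \<in> causal_cone \<or> w - z \<in> causal_cone"
proof (cases "x = y")
  case True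
  then have "z = x" "w = x"
    using causal_cone_antisym[of "z - x"] causal_cone_antisym[of "w - x"] z w by auto
  then show ?thesis by (simp add: causal_cone_def)
next
  case False
  obtain k where k: "z = x + k *\<^sub>R (y - x)"
    using null_interval[OF x y c z False] .
  obtain l where l: "w = x + l *\<^sub>R (y - x)"
    using null_interval[OF x y c w False] .
  have "y - x \<in> causal_cone"
    using causal_cone_add[OF z] by simp
  moreover have "z - w = (k - l) *\<^sub>R (y - x)" "w - z = (l - k) *\<^sub>R (y - x)"
    unfolding k l by (simp_all only: scaleR_left_diff_distrib add_diff_cancel_left)
  ultimately show ?thesis
    using causal_cone_scaleR[of "y - x" "k - l"] causal_cone_scaleR[of "y - x" "l - k"]
    by (cases "l \<le> k") simp_all
qed

section \<open>Null lines, separating points and common upper bounds\<close>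

text \<open>The pairing of \<open>x\<close> with \<open>y + t *\<^sub>R v\<close> is affine in
  \<open>t\<close> with slope \<open>lorentz x v\<close>; the threshold is the parameter at which it
  equals 1.\<close>

lemma null_line_eventually_above:
  assumes x: "x \<in> hyperboloid" and y: "y \<in> hyperboloid" and v: "v \<in> null_cone"
    and yv: "lorentz y v = 0" and xv: "lorentz x v > 0"
  obtains T where "\<And>t. T \<le> t \<Longrightarrow> y + t *\<^sub>R v - x \<in> causal_cone"
proof (rule that[of "(1 - lorentz x y) / lorentz x v"])
  fix t assume "(1 - lorentz x y) / lorentz x v \<le> t"
  then have "1 \<le> lorentz x (y + t *\<^sub>R v)"
    using xv by (simp add: field_simps)
  then show "y + t *\<^sub>R v - x \<in> causal_cone"
    using xv yv null_cone_lorentz[OF v] lorentz_commute[of v y] lorentz_commute[of v x]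
    by (intro hyperboloid_causal_diffI[OF x null_line_hyperboloid[OF y v yv] _ null_cone_causal[OF v]])
      simp_all
qed

text \<open>The point \<^term>\<open>p\<close> is found far out towards \<^term>\<open>v\<close> in the plane spanned by \<^term>\<open>q\<close> and \<^term>\<open>v\<close>.\<close>

lemma exists_future_separating:
  assumes v: "v \<in> null_cone" and q: "q \<in> hyperboloid"
    and qv: "lorentz q v > 0" and vw: "lorentz v w < 0"
  obtains p where "p \<in> hyperboloid" "p - q \<in> causal_cone" "lorentz p v > 0" "lorentz p w \<le> 0"
proof -
  define g d m where "g = lorentz q v" and "d = - lorentz v w" and "m = \<bar>lorentz q w\<bar>"
  have g: "g > 0" and d: "d > 0" and m: "m \<ge> 0"
    using qv vw by (simp_all add: g_def d_def m_def)
  \<comment> \<open>With \<open>p = a *\<^sub>R q + b *\<^sub>R v\<close>, \<open>a * a = r\<close>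
    and \<open>p\<close> on the hyperboloid, \<open>lorentz p w\<close> is nonpositive as soon as
    \<open>2 * g * m * r \<le> (1 - r) * d\<close>. This choice of \<open>r\<close> satisfies it and
    lies strictly between 0 and 1.\<close>
  define r where "r = d / (2 * g * m + d + 1)"
  have gm: "0 \<le> 2 * g * m"
    using g m by simp
  then have den: "2 * g * m + d + 1 > 0"
    using d by linarith
  have r: "0 < r" "r < 1"
    using den d gm by (simp_all add: r_def del: zero_le_mult_iff)
  define a where "a = sqrt r"
  have aa: "a * a = r" and a: "0 < a" "a < 1"
    using r by (simp_all add: a_def)
  define b where "b = (1 - r) / (2 * a * g)"
  define p where "p = a *\<^sub>R q + b *\<^sub>R v"
  have vq: "lorentz v q = g" and vv: "lorentz v v = 0" and qq: "lorentz q q = 1"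
    using null_cone_lorentz[OF v] q lorentz_commute[of v q] by (auto simp: g_def hyperboloid_iff)
  have abg: "2 * (a * b * g) = 1 - r"
    using a g by (simp add: b_def)
  have "lorentz p p = a * a + 2 * (a * b * g)"
    by (simp add: p_def qq vv vq flip: g_def) (simp add: algebra_simps)
  then have pH: "p \<in> hyperboloid"
    by (simp add: hyperboloid_iff abg aa)
  have pv: "lorentz p v = a * g" "lorentz v p = a * g"
    by (simp_all add: p_def vv vq flip: g_def)
  have "2 * a * lorentz q p = 2 * (a * a) + 2 * (a * b * g)"
    by (simp add: p_def qq flip: g_def) (simp add: algebra_simps)
  also have "\<dots> = 1 + r"
    unfolding abg aa by simp
  \<comment> \<open>Arithmetic-geometric mean inequality for \<open>r = a * a\<close> and 1.\<close>
  also have "1 + r \<ge> 2 * a"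
    using aa sum_squares_bound[of a 1] by (simp add: power2_eq_square)
  finally have "1 \<le> lorentz q p"
    using a mult_less_cancel_left_pos[of "2 * a" "lorentz q p" 1] by linarith
  then have pq: "p - q \<in> causal_cone"
    by (rule hyperboloid_causal_diffI[OF q pH _ null_cone_causal[OF v]])
      (use a g in \<open>simp add: pv vq\<close>)
  have "r * (2 * g * m + d + 1) = d"
    using den by (simp add: r_def)
  then have "2 * g * m * r + d * r + r = d"
    by (simp add: algebra_simps)
  then have "2 * g * m * r \<le> (1 - r) * d"
    using r by (simp add: algebra_simps)
  have "2 * a * g * lorentz p w = 2 * g * (a * a) * lorentz q w - 2 * (a * b * g) * d"
    by (simp add: p_def d_def algebra_simps)
  also have "\<dots> \<le> 2 * g * m * r - (1 - r) * d"
  proof -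
    have "2 * g * r * lorentz q w \<le> 2 * g * r * m"
      using g r by (intro mult_left_mono) (simp_all add: m_def)
    then show ?thesis
      unfolding abg aa by (simp add: algebra_simps)
  qed
  also have "\<dots> \<le> 0"
    using \<open>2 * g * m * r \<le> (1 - r) * d\<close> by simp
  finally have "lorentz p w \<le> 0"
    using a g by (simp add: mult_le_0_iff)
  then show thesis
    using that[OF pH pq] pv a g by simp
qed

text \<open>The causal vectors \<open>x + p\<close> and \<open>z - x\<close> have a nonpositive
  pairing. It expands to \<open>lorentz x z + lorentz p z - 1 - lorentz x p\<close>, which is at
  least 2.\<close>

lemma no_common_future:
  assumes x: "x \<in> hyperboloid" and p: "p \<in> hyperboloid" and z: "z \<in> hyperboloid"
    and xp: "x + p \<in> causal_cone" and zx: "z - x \<in> causal_cone" and zp: "z - p \<in> causal_cone"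
  shows False
proof -
  have "lorentz x p \<le> - 1"
    using causal_cone_lorentz[OF xp] lorentz_add_self[OF x p] by simp
  moreover have "lorentz (x + p) (z - x) \<le> 0"
    by (rule lorentz_causal_nonpos[OF xp zx])
  then have "lorentz x z + lorentz p z - 1 - lorentz x p \<le> 0"
    using x lorentz_commute[of p x] by (simp add: hyperboloid_iff)
  moreover have "1 \<le> lorentz x z" "1 \<le> lorentz p z"
    using causal_hyperboloid_ge x p z zx zp by blast+
  ultimately show False by linarith
qed

text \<open>A large multiple of \<open>x + y\<close> pairs with both points as strongly as desired.
  Adding a multiple of \<open>v\<close>, which is orthogonal to \<open>x\<close> and
  \<open>y\<close>, keeps these pairings and corrects the Lorentz square.\<close>

lemma exists_common_future:
  assumes v: "v \<in> null_cone" and x: "x \<in> hyperboloid" and y: "y \<in> hyperboloid"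
    and xv: "lorentz x v = 0" and yv: "lorentz y v = 0" and xy: "lorentz x y > - 1"
  obtains z where "z \<in> hyperboloid" "z - x \<in> causal_cone" "z - y \<in> causal_cone"
proof -
  define w :: "real \<times> (real ^ 'a)" where "w = (1, 0)"
  have vw: "lorentz v w < 0"
    using v by (simp add: w_def lorentz_eq null_cone_def)
  have vx: "lorentz v x = 0" "lorentz v y = 0" "lorentz v v = 0" "lorentz y x = lorentz x y"
    "lorentz x x = 1" "lorentz y y = 1"
    using xv yv x y null_cone_lorentz[OF v] lorentz_commute[of v x] lorentz_commute[of v y]
      lorentz_commute[of x y] by (auto simp: hyperboloid_iff)
  \<comment> \<open>\<open>A\<close> absorbs the unknown pairings of \<open>w\<close> with
    \<open>x\<close> and \<open>y\<close>; \<open>w\<close> itself is there to make the pairing with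
    \<open>v\<close> nonzero, so that \<open>B\<close> exists.\<close>
  define A where "A = (1 + \<bar>lorentz x w\<bar> + \<bar>lorentz y w\<bar>) / (1 + lorentz x y)"
  define m where "m = A *\<^sub>R (x + y) + w"
  define B where "B = (1 - lorentz m m) / (2 * lorentz v w)"
  define z where "z = m + B *\<^sub>R v"
  have vm: "lorentz v m = lorentz v w" "lorentz m v = lorentz v w"
    using vx xv yv lorentz_commute[of v w] by (simp_all add: m_def)
  have A: "A * (1 + lorentz x y) = 1 + \<bar>lorentz x w\<bar> + \<bar>lorentz y w\<bar>"
    using xy by (simp add: A_def)
  have Bvw: "2 * (B * lorentz v w) = 1 - lorentz m m"
    using vw by (simp add: B_def)
  have "lorentz z z = lorentz m m + 2 * (B * lorentz v w)"
    by (simp add: z_def vm vx)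
  then have z: "z \<in> hyperboloid"
    using Bvw by (simp add: hyperboloid_iff)
  have vz: "lorentz v z = lorentz v w"
    by (simp add: z_def vm vx)
  have "lorentz x z = A * (1 + lorentz x y) + lorentz x w"
    by (simp add: z_def m_def vx xv algebra_simps)
  then have xz: "1 \<le> lorentz x z"
    unfolding A by linarith
  have "lorentz y z = A * (1 + lorentz x y) + lorentz y w"
    by (simp add: z_def m_def vx yv algebra_simps)
  then have yz: "1 \<le> lorentz y z"
    unfolding A by linarith
  have "z - x \<in> causal_cone"
    by (rule hyperboloid_causal_diffI[OF x z xz null_cone_causal[OF v]]) (simp add: vz vx vw)
  moreover have "z - y \<in> causal_cone"
    by (rule hyperboloid_causal_diffI[OF y z yz null_cone_causal[OF v]]) (simp add: vz vx vw)
  ultimately show thesis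
    using that[OF z] by simp
qed

section \<open>Null vectors and frames adapted to a point or a null direction\<close>

text \<open>Two independent null directions through one point will determine
  \<open>f x + f (- x)\<close>.\<close>

lemma exists_null_orthogonal_pair:
  fixes x :: "real \<times> (real ^ 'n)"
  assumes card: "CARD('n) \<ge> 3" and x: "x \<in> hyperboloid"
  obtains v w where "v \<in> null_cone" "w \<in> null_cone" "lorentz x v = 0" "lorentz x w = 0" "lorentz v w < 0"
proof -
  obtain e :: "real ^ 'n" where e: "norm e = 1" "e \<bullet> snd x = 0"
    by (rule exists_orthogonal_unit[of "snd x" "snd x"]) (use card in auto)
  define n where "n = norm (snd x)"
  have n2: "n * n = 1 + fst x * fst x"
    using x by (simp add: hyperboloid_iff lorentz_self n_def power2_eq_square)
  have "n * n > 0"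
    unfolding n2 using zero_le_square[of "fst x"] by linarith
  then have n0: "n > 0"
    using norm_ge_zero[of "snd x"] by (auto simp: n_def less_le)
  have ss: "snd x \<bullet> snd x = n * n" "snd x \<bullet> e = 0" "e \<bullet> e = 1"
    using e by (simp_all add: n_def norm_eq_1 inner_commute[of "snd x" e] dot_square_norm power2_eq_square)
  \<comment> \<open>The vector \<open>(n * n, fst x *\<^sub>R snd x)\<close> is orthogonal to
    \<open>x\<close> and has Lorentz square \<open>- (n * n)\<close>; adding
    \<open>n *\<^sub>R e\<close> or its negative makes it null.\<close>
  define v where "v \<sigma> = (n * n, fst x *\<^sub>R snd x + (\<sigma> * n) *\<^sub>R e)" for \<sigma> :: real
  have vv: "lorentz (v \<sigma>) (v \<tau>) = n * n * (\<sigma> * \<tau> - 1)" for \<sigma> \<tau>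
  proof -
    have "lorentz (v \<sigma>) (v \<tau>) = fst x * fst x * (n * n) + \<sigma> * \<tau> * (n * n) - n * n * (n * n)"
      by (simp add: v_def lorentz_eq inner_simps ss e algebra_simps)
    also have "\<dots> = n * n * (\<sigma> * \<tau> - 1) + n * n * (1 + fst x * fst x - n * n)"
      by (simp add: algebra_simps)
    finally show ?thesis
      by (simp add: n2)
  qed
  have null: "v \<sigma> \<in> null_cone" if "\<sigma> * \<sigma> = 1" for \<sigma>
  proof -
    have "(norm (snd (v \<sigma>)))\<^sup>2 = (fst (v \<sigma>))\<^sup>2"
      using vv[of \<sigma> \<sigma>] that by (simp add: lorentz_self)
    moreover have "0 < fst (v \<sigma>)"
      using n0 by (simp add: v_def)
    ultimately show ?thesis
      by (simp add: null_cone_def)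
  qed
  have "lorentz x (v \<sigma>) = 0" for \<sigma>
    by (simp add: v_def lorentz_eq inner_simps ss algebra_simps)
  then show thesis
    using that[OF null[of 1] null[of "-1"]] vv[of 1 "-1"] n0 by simp
qed

text \<open>Coordinates for the half-space picture of \<open>v\<close>: two orthonormal horizontal
  directions and an opposite null vector. The spatial vectors \<open>snd v\<close>,
  \<open>e1\<close>, \<open>e2\<close> can be pairwise orthogonal because the dimension is at least
  3.\<close>

lemma exists_frame:
  fixes v :: "real \<times> (real ^ 'n)"
  assumes card: "CARD('n) \<ge> 3" and v: "v \<in> null_cone"
  obtains y z w where "y \<in> hyperboloid" "z \<in> hyperboloid" "lorentz y v = 0" "lorentz z v = 0"
    "lorentz y z = 0" "lorentz w w = 0" "lorentz w y = 0" "lorentz w z = 0" "lorentz w v < 0"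
proof -
  obtain e1 :: "real ^ 'n" where e1: "norm e1 = 1" "e1 \<bullet> snd v = 0"
    by (rule exists_orthogonal_unit[of "snd v" "snd v"]) (use card in auto)
  obtain e2 :: "real ^ 'n" where e2: "norm e2 = 1" "e2 \<bullet> snd v = 0" "e2 \<bullet> e1 = 0"
    by (rule exists_orthogonal_unit[of "snd v" "e1"]) (use card in auto)
  have "snd v \<bullet> snd v = fst v * fst v" "0 < fst v"
    using v by (auto simp: null_cone_def power2_eq_square simp flip: power2_norm_eq_inner)
  then show thesis
    using e1 e2
    by (intro that[of "(0, e1)" "(0, e2)" "(fst v, - snd v)"])
      (auto simp: hyperboloid_iff lorentz_eq inner_commute norm_eq_1)
qed

lemma exists_hyperboloid_null_pos:
  assumes v: "v \<in> null_cone"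
  obtains x where "x \<in> hyperboloid" "lorentz x v > 0"
proof (rule that[of "(0, snd v /\<^sub>R norm (snd v))"])
  have n: "norm (snd v) > 0"
    using v by (simp add: null_cone_def)
  then show "(0, snd v /\<^sub>R norm (snd v)) \<in> hyperboloid"
    by (simp add: hyperboloid_iff lorentz_self)
  show "lorentz (0, snd v /\<^sub>R norm (snd v)) v > 0"
    using n by (simp add: lorentz_eq)
qed

section \<open>Monotone functions with translation-invariant increments\<close>

text \<open>Invariance makes \<open>F - F 0\<close> additive, and a monotone additive function is
  linear.\<close>

lemma affine_if_increments_translation_invariant:
  fixes F :: "real \<Rightarrow> real"
  assumes F: "mono F"
    and inv: "\<And>a b \<rho>. 0 < \<rho> \<Longrightarrow> F (a + \<rho>) - F (a - \<rho>) = F (b + \<rho>) - F (b - \<rho>)"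
  shows "F t = F 0 + t * (F 1 - F 0)"
proof -
  define h where "h s = F s - F 0" for s
  have h0: "h 0 = 0"
    by (simp add: h_def)
  have hmono: "h s \<le> h t" if "s \<le> t" for s t
    using monoD[OF F that] by (simp add: h_def)
  have add: "h (a + s) = h a + h s" if "0 < s" for a s
    using inv[of "s / 2" "a + s / 2" "s / 2"] that by (simp add: h_def algebra_simps)
  have mult: "h (real n * s) = real n * h s" if "0 < s" for n s
    by (induction n) (simp_all add: h0 add[OF that] distrib_right add.commute[of s])
  have pos: "h t = t * h 1" if t: "0 < t" for t
  proof (rule ccontr)
    assume "h t \<noteq> t * h 1"
    then have "0 < \<bar>h t - t * h 1\<bar>"
      by simp
    \<comment> \<open>The error of \<open>h\<close> at \<open>n * t\<close> is \<open>n\<close>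
      times the error at \<open>t\<close>, yet monotonicity between the integers \<open>k\<close>
      and \<open>k + 1\<close> around \<open>n * t\<close> bounds it by \<open>h 1\<close>.\<close>
    then obtain n where n: "h 1 < real n * \<bar>h t - t * h 1\<bar>"
      using ex_less_of_nat_mult by blast
    define k where "k = nat \<lfloor>real n * t\<rfloor>"
    have "0 \<le> real n * t"
      using t by simp
    then have k: "real k \<le> real n * t" "real n * t \<le> real (Suc k)"
      unfolding k_def by linarith+
    have "real k * h 1 \<le> real n * h t" "real n * h t \<le> real (Suc k) * h 1"
      using hmono[OF k(1)] hmono[OF k(2)] mult[of 1 k] mult[of 1 "Suc k"] mult[OF t, of n]
      by simp_all
    moreover have "0 \<le> h 1"
      using hmono[of 0 1] h0 by simp
    then have "real k * h 1 \<le> real n * t * h 1" "real n * t * h 1 \<le> real (Suc k) * h 1"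
      using mult_right_mono[OF k(1)] mult_right_mono[OF k(2)] by blast+
    ultimately have "\<bar>real n * h t - real n * t * h 1\<bar> \<le> h 1"
      by (simp add: distrib_right abs_le_iff)
    moreover have "\<bar>real n * h t - real n * t * h 1\<bar> = real n * \<bar>h t - t * h 1\<bar>"
    proof -
      have "real n * h t - real n * t * h 1 = real n * (h t - t * h 1)"
        by (simp add: algebra_simps)
      then show ?thesis
        by (simp add: abs_mult)
    qed
    ultimately show False
      using n by simp
  qed
  have "h t = t * h 1"
  proof (cases "0 < t \<or> t = 0")
    case True
    then show ?thesis using pos[of t] h0 by auto
  next
    case False
    then have "0 < - t" by simp
    from add[OF this, of t] pos[OF this] show ?thesis
      by (simp add: h0)
  qed
  then show ?thesis
    by (simp add: h_def algebra_simps)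
qed

section \<open>The map as an order embedding that respects lightlike pairs\<close>

locale future_preserving =
  fixes f :: "real \<times> (real ^ 'n) \<Rightarrow> real \<times> (real ^ 'n)"
  assumes card: "CARD('n) \<ge> 3"
    and maps: "f \<in> hyperboloid \<rightarrow> hyperboloid"
    and inj: "inj_on f hyperboloid"
    and image_future: "\<And>x. x \<in> hyperboloid \<Longrightarrow> f ` future x = future (f x)"
begin

lemma f_hyperboloid: "x \<in> hyperboloid \<Longrightarrow> f x \<in> hyperboloid"
  using maps by blast

text \<open>This replaces surjectivity: points of the target are pulled back only after they are
  known to lie above some image point.\<close>

lemma future_preimage:
  assumes "x \<in> hyperboloid" "z \<in> hyperboloid" "z - f x \<in> causal_cone"
  obtains y where "y \<in> hyperboloid" "z = f y" "y - x \<in> causal_cone"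
proof -
  have "z \<in> f ` future x"
    using assms by (simp add: image_future future_iff f_hyperboloid)
  then show thesis
    using that future_iff[OF assms(1)] by blast
qed

lemma f_causal_iff:
  assumes x: "x \<in> hyperboloid" and y: "y \<in> hyperboloid"
  shows "f y - f x \<in> causal_cone \<longleftrightarrow> y - x \<in> causal_cone"
proof
  assume "f y - f x \<in> causal_cone"
  then obtain z where "z \<in> hyperboloid" "f y = f z" "z - x \<in> causal_cone"
    using future_preimage[OF x f_hyperboloid[OF y]] by blast
  then show "y - x \<in> causal_cone"
    using inj_onD[OF inj, of y z] y by simp
next
  assume "y - x \<in> causal_cone"
  then have "f y \<in> f ` future x"
    using future_iff[OF x] y by blast
  then show "f y - f x \<in> causal_cone"
    using image_future[OF x] future_iff[OF f_hyperboloid[OF x]] by blast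
qed

text \<open>Among comparable pairs, the lightlike ones are those whose order interval is a chain.\<close>

lemma f_null_iff:
  assumes x: "x \<in> hyperboloid" and y: "y \<in> hyperboloid" and xy: "y - x \<in> causal_cone"
  shows "lorentz (f x) (f y) = 1 \<longleftrightarrow> lorentz x y = 1"
proof
  have fxy: "f y - f x \<in> causal_cone"
    using f_causal_iff x y xy by blast
  note fx = f_hyperboloid[OF x] and fy = f_hyperboloid[OF y]
  show "lorentz (f x) (f y) = 1" if c: "lorentz x y = 1"
  proof (rule ccontr)
    assume "lorentz (f x) (f y) \<noteq> 1"
    then have "lorentz (f x) (f y) > 1"
      using causal_hyperboloid_ge[OF fx fy fxy] by simp
    then obtain z' w' where zw': "z' \<in> hyperboloid" "w' \<in> hyperboloid"
      "z' - f x \<in> causal_cone" "f y - z' \<in> causal_cone"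
      "w' - f x \<in> causal_cone" "f y - w' \<in> causal_cone"
      "z' - w' \<notin> causal_cone" "w' - z' \<notin> causal_cone"
      by (rule timelike_interval_not_chain[OF card fx fy fxy])
    obtain z where z: "z \<in> hyperboloid" "z' = f z" "z - x \<in> causal_cone"
      using future_preimage[OF x zw'(1,3)] .
    obtain w where w: "w \<in> hyperboloid" "w' = f w" "w - x \<in> causal_cone"
      using future_preimage[OF x zw'(2,5)] .
    have "y - z \<in> causal_cone" "y - w \<in> causal_cone"
      "z - w \<notin> causal_cone" "w - z \<notin> causal_cone"
      using zw' z w y f_causal_iff by blast+
    then show False
      using null_interval_chain[OF x y c z(3) _ w(3)] by blast
  qed
  show "lorentz x y = 1" if c: "lorentz (f x) (f y) = 1"
  proof (rule ccontr)
    assume "lorentz x y \<noteq> 1"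
    then have "lorentz x y > 1"
      using causal_hyperboloid_ge[OF x y xy] by simp
    then obtain z w where zw: "z \<in> hyperboloid" "w \<in> hyperboloid"
      "z - x \<in> causal_cone" "y - z \<in> causal_cone" "w - x \<in> causal_cone" "y - w \<in> causal_cone"
      "z - w \<notin> causal_cone" "w - z \<notin> causal_cone"
      by (rule timelike_interval_not_chain[OF card x y xy])
    then have "f z - f x \<in> causal_cone" "f y - f z \<in> causal_cone"
      "f w - f x \<in> causal_cone" "f y - f w \<in> causal_cone"
      "f z - f w \<notin> causal_cone" "f w - f z \<notin> causal_cone"
      using f_causal_iff x y by blast+
    then show False
      using null_interval_chain[OF fx fy c] by blast
  qed
qed

section \<open>Images of null lines and their directions\<close>

text \<open>\<open>F\<close> is the induced reparametrisation. Only unboundedness above is recorded,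
  since the image of \<open>f\<close> is an up-set; continuity of \<open>F\<close> is not part of
  the notion.\<close>

definition maps_null_line where
  "maps_null_line y v v' F \<longleftrightarrow> v' \<in> null_cone \<and> lorentz (f y) v' = 0 \<and> strict_mono F \<and>
    (\<forall>M. \<exists>t. M \<le> F t) \<and> (\<forall>t. f (y + t *\<^sub>R v) = f y + F t *\<^sub>R v')"

text \<open>Any two points of the line have pairing 1, and so have their images. Differences of
  images from \<open>f y\<close> are then null and orthogonal to \<open>v'\<close>, hence multiples
  of \<open>v'\<close>.\<close>

lemma exists_maps_null_line:
  assumes y: "y \<in> hyperboloid" and v: "v \<in> null_cone" and yv: "lorentz y v = 0"
  obtains v' F where "maps_null_line y v v' F"
proof -
  define p where "p t = y + t *\<^sub>R v" for t
  have p: "p t \<in> hyperboloid" for t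
    unfolding p_def by (rule null_line_hyperboloid[OF y v yv])
  have p0: "p 0 = y"
    by (simp add: p_def)
  have vy: "lorentz v y = 0" "lorentz v v = 0" "lorentz y y = 1"
    using yv lorentz_commute[of v y] null_cone_lorentz[OF v] y by (auto simp: hyperboloid_iff)
  have pp: "lorentz (p s) (p t) = 1" for s t
    by (simp add: p_def vy yv)
  have up: "p t - p s \<in> causal_cone" if "s < t" for s t
  proof -
    have "p t - p s = (t - s) *\<^sub>R v"
      by (simp add: p_def scaleR_left_diff_distrib)
    then show ?thesis
      using causal_cone_scaleR[OF null_cone_causal[OF v], of "t - s"] that by simp
  qed
  have fp: "f (p t) \<in> hyperboloid" for t
    by (rule f_hyperboloid[OF p])
  have fup: "f (p t) - f (p s) \<in> causal_cone" if "s < t" for s t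
    using f_causal_iff[OF p p] up[OF that] by blast
  have fpp1: "lorentz (f (p s)) (f (p t)) = 1" if "s < t" for s t
    using f_null_iff[OF p p up[OF that]] pp by blast
  then have fpp: "lorentz (f (p s)) (f (p t)) = 1" for s t
    using fp[of s] lorentz_commute[of "f (p s)" "f (p t)"]
    by (cases s t rule: linorder_cases) (simp_all add: hyperboloid_iff)
  have ne: "f (p t) \<noteq> f (p s)" if "s \<noteq> t" for s t
  proof
    assume "f (p t) = f (p s)"
    then have "p t = p s"
      using inj_onD[OF inj] p by blast
    then show False
      using that null_cone_nonzero[OF v] by (simp add: p_def)
  qed
  define v' where "v' = f (p 1) - f (p 0)"
  have v': "v' \<in> null_cone"
    unfolding null_cone_iff v'_def using fup[of 0 1] fpp ne[of 0 1] by simp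
  have "\<exists>k. f (p t) - f (p 0) = k *\<^sub>R v'" for t
  proof -
    have "lorentz v' (f (p t) - f (p 0)) = 0" "lorentz (f (p t) - f (p 0)) (f (p t) - f (p 0)) = 0"
      by (simp_all add: v'_def fpp)
    then show ?thesis
      using null_orthogonal[OF v', of "f (p t) - f (p 0)"] by (metis order_refl)
  qed
  then obtain F where F: "\<And>t. f (p t) - f (p 0) = F t *\<^sub>R v'"
    by metis
  have line: "f (p t) = f y + F t *\<^sub>R v'" for t
    using F[of t] p0 by (metis add.commute diff_add_cancel)
  have v'0: "v' \<noteq> 0"
    by (rule null_cone_nonzero[OF v'])
  have mono: "F s < F t" if "s < t" for s t
  proof -
    have d: "f (p t) - f (p s) = (F t - F s) *\<^sub>R v'"
      by (simp add: line scaleR_left_diff_distrib)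
    have "0 \<le> F t - F s"
      using scaleR_causal_imp_nonneg[OF v'] fup[OF that] unfolding d by blast
    moreover have "F t \<noteq> F s"
      using d ne[of s t] that by auto
    ultimately show ?thesis by simp
  qed
  have yv': "lorentz (f y) v' = 0"
    using fpp[of 0] by (simp add: v'_def flip: p0)
  \<comment> \<open>Any far point \<open>z'\<close> of the image line lies above \<open>f y\<close>
    and is therefore some \<open>f z\<close>; it remains to place \<open>z\<close> on the source
    line. The maximum with 0 ensures \<open>z'\<close> is above \<open>f y\<close>.\<close>
  have "\<exists>t. M \<le> F t" for M
  proof -
    define K where "K = max M 0"
    define z' where "z' = f y + K *\<^sub>R v'"
    have z': "z' \<in> hyperboloid"
      unfolding z'_def by (rule null_line_hyperboloid[OF f_hyperboloid[OF y] v' yv'])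
    have "z' - f y \<in> causal_cone"
      using causal_cone_scaleR[OF null_cone_causal[OF v'], of K] by (simp add: z'_def K_def)
    then obtain z where z: "z \<in> hyperboloid" "z' = f z" "z - y \<in> causal_cone"
      using future_preimage[OF y z'] by blast
    have "lorentz (f y) (f z) = 1"
      using yv' f_hyperboloid[OF y] by (simp add: z'_def hyperboloid_iff flip: z(2))
    then have "lorentz y z = 1"
      using f_null_iff[OF y z(1,3)] by simp
    then have zz: "lorentz (z - y) (z - y) = 0"
      using lorentz_diff_self[OF y z(1)] by simp
    \<comment> \<open>Comparability of \<open>z\<close> with the second point
      \<open>p 1 = y + v\<close> yields \<open>0 \<le> lorentz v (z - y)\<close>; causality of
      \<open>z - y\<close> yields the reverse inequality.\<close>
    have "f z - f (p 1) = (K - F 1) *\<^sub>R v'" "f (p 1) - f z = (F 1 - K) *\<^sub>R v'"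
      by (simp_all add: line z'_def scaleR_left_diff_distrib flip: z(2))
    then have "f z - f (p 1) \<in> causal_cone \<or> f (p 1) - f z \<in> causal_cone"
      using causal_cone_scaleR[OF null_cone_causal[OF v'], of "K - F 1"]
        causal_cone_scaleR[OF null_cone_causal[OF v'], of "F 1 - K"]
      by (cases "F 1 \<le> K") simp_all
    then have "z - p 1 \<in> causal_cone \<or> p 1 - z \<in> causal_cone"
      using f_causal_iff p z(1) by blast
    then have "lorentz (z - p 1) (z - p 1) \<le> 0"
      using causal_cone_lorentz[of "z - p 1"] causal_cone_lorentz[of "p 1 - z"]
      by (auto simp: algebra_simps)
    moreover have "z - p 1 = (z - y) - v"
      by (simp add: p_def)
    moreover have "lorentz ((z - y) - v) ((z - y) - v)
        = lorentz (z - y) (z - y) - 2 * lorentz v (z - y) + lorentz v v"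
      using lorentz_commute[of v z] lorentz_commute[of v y] by simp
    ultimately have "0 \<le> lorentz v (z - y)"
      using zz vy by simp
    then have "lorentz v (z - y) = 0"
      using lorentz_causal_nonpos[OF null_cone_causal[OF v] z(3)] by simp
    then obtain k where "z - y = k *\<^sub>R v"
      using null_causal_orthogonal[OF v z(3)] by blast
    then have "z = p k"
      unfolding p_def by (metis add.commute diff_add_cancel)
    then have "K *\<^sub>R v' = F k *\<^sub>R v'"
      using z(2) line[of k] by (simp add: z'_def)
    then have "F k = K"
      using v'0 by simp
    then show ?thesis
      by (intro exI[of _ k]) (simp add: K_def)
  qed
  then have "maps_null_line y v v' F"
    unfolding maps_null_line_def using v' yv' mono line
    by (auto simp: p_def strict_mono_def)
  then show thesis
    by (rule that)
qed

text \<open>A positive slope \<open>lorentz x v\<close> puts \<open>x\<close> below all far points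
  of the line. On the image side a negative slope contradicts the unboundedness of \<open>F\<close>,
  and slope zero puts \<open>f x\<close> on the image line, so that \<open>x\<close> would be
  lightlike to all far points. The converse is similar.\<close>

lemma maps_null_line_sign:
  assumes y: "y \<in> hyperboloid" and v: "v \<in> null_cone" and yv: "lorentz y v = 0"
    and line: "maps_null_line y v v' F" and x: "x \<in> hyperboloid"
  shows "lorentz (f x) v' > 0 \<longleftrightarrow> lorentz x v > 0"
proof
  have v': "v' \<in> null_cone" and yv': "lorentz (f y) v' = 0" and mono: "strict_mono F"
    and unb: "\<And>M. \<exists>t. M \<le> F t" and f_line: "\<And>t. f (y + t *\<^sub>R v) = f y + F t *\<^sub>R v'"
    using line by (auto simp: maps_null_line_def)
  note fx = f_hyperboloid[OF x] and fy = f_hyperboloid[OF y]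
  have p: "y + t *\<^sub>R v \<in> hyperboloid" for t
    by (rule null_line_hyperboloid[OF y v yv])
  have v'0: "lorentz v' v' = 0" "lorentz v' (f y) = 0"
    using null_cone_lorentz[OF v'] yv' lorentz_commute[of v' "f y"] by auto
  have F_mono: "F s \<le> F t" if "s \<le> t" for s t
    using mono that by (simp add: strict_mono_less_eq)
  show "lorentz (f x) v' > 0" if xv: "lorentz x v > 0"
  proof -
    obtain T where T: "\<And>t. T \<le> t \<Longrightarrow> y + t *\<^sub>R v - x \<in> causal_cone"
      using null_line_eventually_above[OF x y v yv xv] by blast
    have ge: "1 \<le> lorentz (f x) (f y) + F t * lorentz (f x) v'" if "T \<le> t" for t
    proof -
      have "f (y + t *\<^sub>R v) - f x \<in> causal_cone"
        using f_causal_iff[OF x p] T[OF that] by blast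
      then have "1 \<le> lorentz (f x) (f (y + t *\<^sub>R v))"
        by (rule causal_hyperboloid_ge[OF fx f_hyperboloid[OF p]])
      then show ?thesis
        by (simp add: f_line)
    qed
    show ?thesis
    proof (rule ccontr)
      assume "\<not> lorentz (f x) v' > 0"
      then consider "lorentz (f x) v' < 0" | "lorentz (f x) v' = 0"
        by linarith
      then show False
      proof cases
        case 1
        define M where "M = (1 - lorentz (f x) (f y)) / lorentz (f x) v' + 1"
        obtain t where t: "M \<le> F t"
          using unb by blast
        have "M \<le> F (max t T)"
          using t F_mono[of t "max t T"] by simp
        then have "F (max t T) * lorentz (f x) v' \<le> M * lorentz (f x) v'"
          using 1 by (simp add: mult_right_mono_neg)
        also have "\<dots> = 1 - lorentz (f x) (f y) + lorentz (f x) v'"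
          using 1 by (simp add: M_def distrib_right)
        finally show False
          using ge[of "max t T"] 1 by simp
      next
        case 2
        have "1 \<le> lorentz (f x) (f y)"
          using ge[of T] 2 by simp
        then have "lorentz (f x - f y) (f x - f y) \<le> 0"
          using lorentz_diff_self[OF fy fx] lorentz_commute[of "f x" "f y"] by simp
        moreover have "lorentz v' (f x - f y) = 0"
          using 2 v'0 lorentz_commute[of v' "f x"] by simp
        ultimately obtain k where "f x - f y = k *\<^sub>R v'"
          using null_orthogonal[OF v'] by blast
        then have fxk: "f x = f y + k *\<^sub>R v'"
          by (metis add.commute diff_add_cancel)
        have "lorentz (f x) (f (y + t *\<^sub>R v)) = 1" for t
          unfolding f_line fxk using fy by (simp add: v'0 yv' hyperboloid_iff)
        then have "lorentz x (y + t *\<^sub>R v) = 1" if "T \<le> t" for t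
          using f_null_iff[OF x p T[OF that]] by blast
        from this[of T] this[of "T + 1"] show False
          using xv by (simp add: distrib_right)
      qed
    qed
  qed
  show "lorentz x v > 0" if fxv: "lorentz (f x) v' > 0"
  proof -
    obtain S where S: "\<And>s. S \<le> s \<Longrightarrow> f y + s *\<^sub>R v' - f x \<in> causal_cone"
      using null_line_eventually_above[OF fx fy v' yv' fxv] by blast
    obtain t\<^sub>0 where t\<^sub>0: "S \<le> F t\<^sub>0"
      using unb by blast
    have ge: "1 \<le> lorentz x y + t * lorentz x v" if "t\<^sub>0 \<le> t" for t
    proof -
      have "f (y + t *\<^sub>R v) - f x \<in> causal_cone"
        unfolding f_line using S t\<^sub>0 F_mono[OF that] by simp
      then have "y + t *\<^sub>R v - x \<in> causal_cone"
        using f_causal_iff[OF x p] by blast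
      then have "1 \<le> lorentz x (y + t *\<^sub>R v)"
        by (rule causal_hyperboloid_ge[OF x p])
      then show ?thesis by simp
    qed
    show ?thesis
    proof (rule ccontr)
      assume "\<not> lorentz x v > 0"
      then consider "lorentz x v < 0" | "lorentz x v = 0"
        by linarith
      then show False
      proof cases
        case 1
        define M where "M = (1 - lorentz x y) / lorentz x v + 1"
        have "max t\<^sub>0 M * lorentz x v \<le> M * lorentz x v"
          using 1 by (simp add: mult_right_mono_neg)
        also have "\<dots> = 1 - lorentz x y + lorentz x v"
          using 1 by (simp add: M_def distrib_right)
        finally show False
          using ge[of "max t\<^sub>0 M"] 1 by simp
      next
        case 2
        have "1 \<le> lorentz x y"
          using ge[of t\<^sub>0] 2 by simp
        then have "lorentz (x - y) (x - y) \<le> 0"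
          using lorentz_diff_self[OF y x] lorentz_commute[of x y] by simp
        moreover have "lorentz v (x - y) = 0"
          using 2 yv lorentz_commute[of v x] lorentz_commute[of v y] by simp
        ultimately obtain k where "x - y = k *\<^sub>R v"
          using null_orthogonal[OF v] by blast
        then have "x = y + k *\<^sub>R v"
          by (metis add.commute diff_add_cancel)
        then have "f x = f y + F k *\<^sub>R v'"
          using f_line by simp
        then show False
          using fxv v'0 yv' by simp
      qed
    qed
  qed
qed

text \<open>Two null directions with the same sign function on the hyperboloid coincide, because otherwise
  \<open>exists_future_separating\<close> separates them.\<close>

lemma parallel_null_lines:
  assumes y: "y \<in> hyperboloid" and z: "z \<in> hyperboloid" and v: "v \<in> null_cone"
    and yv: "lorentz y v = 0" and zv: "lorentz z v = 0" and line: "maps_null_line y v v' F"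
  obtains G where "maps_null_line z v v' G"
proof -
  obtain w' G where zline: "maps_null_line z v w' G"
    using exists_maps_null_line[OF z v zv] .
  have v': "v' \<in> null_cone" and w': "w' \<in> null_cone"
    using line zline by (auto simp: maps_null_line_def)
  obtain x where x: "x \<in> hyperboloid" "lorentz x v > 0"
    using exists_hyperboloid_null_pos[OF v] .
  have xv': "lorentz (f x) v' > 0"
    using maps_null_line_sign[OF y v yv line] x by blast
  have "\<not> lorentz v' w' < 0"
  proof
    assume "lorentz v' w' < 0"
    then obtain p where p: "p \<in> hyperboloid" "p - f x \<in> causal_cone" "lorentz p v' > 0" "lorentz p w' \<le> 0"
      using exists_future_separating[OF v' f_hyperboloid[OF x(1)] xv'] by blast
    \<comment> \<open>Lying above \<open>f x\<close>, the point \<open>p\<close> is an image; the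
      two sign criteria contradict each other at its preimage \<open>u\<close>.\<close>
    obtain u where u: "u \<in> hyperboloid" "p = f u"
      using future_preimage[OF x(1) p(1,2)] by blast
    then show False
      using maps_null_line_sign[OF y v yv line u(1)] maps_null_line_sign[OF z v zv zline u(1)] p by simp
  qed
  then have "lorentz v' w' = 0"
    using lorentz_causal_nonpos[OF null_cone_causal[OF v'] null_cone_causal[OF w']] by simp
  then obtain c where c: "0 \<le> c" "w' = c *\<^sub>R v'"
    using null_causal_orthogonal[OF v' null_cone_causal[OF w']] by blast
  then have c0: "0 < c"
    using null_cone_nonzero[OF w'] by (auto simp: less_le)
  \<comment> \<open>The positive factor between the two directions is absorbed into the
    parameter.\<close>
  have "\<exists>t. M \<le> G t * c" for M
  proof -
    obtain t where "M / c \<le> G t"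
      using zline unfolding maps_null_line_def by blast
    then show ?thesis
      using c0 by (auto simp: field_simps)
  qed
  then have "maps_null_line z v v' (\<lambda>t. G t * c)"
    using zline c0 v' unfolding maps_null_line_def c(2) by (auto simp: strict_mono_def)
  then show thesis
    by (rule that)
qed

section \<open>Antipodal points\<close>

text \<open>As \<open>x + p\<close> is causal, \<open>x\<close> and \<open>p\<close> have no common
  upper bound, hence neither have \<open>f x\<close> and \<open>f p\<close>. Both images are
  orthogonal to \<open>k'\<close>, so \<open>lorentz (f x) (f p) \<le> - 1\<close>; then
  \<open>f x + f p\<close> is not spacelike and orthogonal to \<open>k'\<close>, hence a multiple of
  it.\<close>

lemma f_null_antipodal:
  assumes x: "x \<in> hyperboloid" and p: "p \<in> hyperboloid" and k: "k \<in> null_cone"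
    and xk: "lorentz x k = 0" and pk: "lorentz p k = 0" and xp: "x + p = c *\<^sub>R k" "0 \<le> c"
    and line: "maps_null_line x k k' F"
  shows "\<exists>\<kappa>. f x + f p = \<kappa> *\<^sub>R k'" and "lorentz (f x) (f p) = - 1"
proof -
  note fx = f_hyperboloid[OF x] and fp = f_hyperboloid[OF p]
  obtain G where pline: "maps_null_line p k k' G"
    using parallel_null_lines[OF x p k xk pk line] .
  have k': "k' \<in> null_cone" and xk': "lorentz (f x) k' = 0" and pk': "lorentz (f p) k' = 0"
    using line pline by (auto simp: maps_null_line_def)
  have xpC: "x + p \<in> causal_cone"
    unfolding xp(1) by (rule causal_cone_scaleR[OF null_cone_causal[OF k] xp(2)])
  have "\<not> lorentz (f x) (f p) > - 1"
  proof
    assume "lorentz (f x) (f p) > - 1"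
    then obtain z' where z': "z' \<in> hyperboloid" "z' - f x \<in> causal_cone" "z' - f p \<in> causal_cone"
      using exists_common_future[OF k' fx fp xk' pk'] by blast
    then obtain z where z: "z \<in> hyperboloid" "z' = f z" "z - x \<in> causal_cone"
      using future_preimage[OF x] by blast
    have "z - p \<in> causal_cone"
      using f_causal_iff[OF p z(1)] z'(3) z(2) by blast
    then show False
      using no_common_future[OF x p z(1) xpC z(3)] by blast
  qed
  then have "lorentz (f x + f p) (f x + f p) \<le> 0"
    using lorentz_add_self[OF fx fp] by simp
  moreover have "lorentz k' (f x + f p) = 0"
    using xk' pk' lorentz_commute[of k' "f x"] lorentz_commute[of k' "f p"] by simp
  ultimately obtain \<kappa> where \<kappa>: "f x + f p = \<kappa> *\<^sub>R k'"
    using null_orthogonal[OF k'] by blast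
  then show "\<exists>\<kappa>. f x + f p = \<kappa> *\<^sub>R k'"
    by blast
  have "lorentz (f x + f p) (f x + f p) = 0"
    unfolding \<kappa> using null_cone_lorentz[OF k'] by simp
  then show "lorentz (f x) (f p) = - 1"
    unfolding lorentz_add_self[OF fx fp] by simp
qed

text \<open>The sum \<open>f x + f (- x)\<close> is a multiple of the image directions of two null
  lines through \<open>x\<close>. It vanishes because these directions are not parallel.\<close>

lemma f_uminus:
  assumes x: "x \<in> hyperboloid"
  shows "f (- x) = - f x"
proof -
  obtain v w where v: "v \<in> null_cone" and w: "w \<in> null_cone"
    and xv: "lorentz x v = 0" and xw: "lorentz x w = 0" and vw: "lorentz v w < 0"
    using exists_null_orthogonal_pair[OF card x] .
  note mx = hyperboloid_uminus[OF x]
  obtain v' F where vline: "maps_null_line x v v' F"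
    using exists_maps_null_line[OF x v xv] .
  obtain w' G where wline: "maps_null_line x w w' G"
    using exists_maps_null_line[OF x w xw] .
  obtain \<kappa> where \<kappa>: "f x + f (- x) = \<kappa> *\<^sub>R v'"
    using f_null_antipodal(1)[OF x mx v xv _ _ _ vline, of 0] xv by auto
  obtain \<mu> where \<mu>: "f x + f (- x) = \<mu> *\<^sub>R w'"
    using f_null_antipodal(1)[OF x mx w xw _ _ _ wline, of 0] xw by auto
  have "\<kappa> = 0"
  proof (rule ccontr)
    assume "\<kappa> \<noteq> 0"
    define r where "r = \<mu> / \<kappa>"
    have "\<kappa> *\<^sub>R v' = \<mu> *\<^sub>R w'"
      using \<kappa> \<mu> by simp
    then have "inverse \<kappa> *\<^sub>R \<kappa> *\<^sub>R v' = inverse \<kappa> *\<^sub>R \<mu> *\<^sub>R w'"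
      by simp
    then have v'w': "v' = r *\<^sub>R w'"
      using \<open>\<kappa> \<noteq> 0\<close> by (simp add: r_def divide_inverse mult.commute)
    have w': "w' \<in> null_cone"
      using wline by (simp add: maps_null_line_def)
    \<comment> \<open>With parallel image directions \<open>f (x + v)\<close> and
      \<open>f (x + w)\<close> would lie on one null line and be comparable, but
      \<open>v - w\<close> is spacelike.\<close>
    have "f (x + 1 *\<^sub>R v) = f x + F 1 *\<^sub>R v'" "f (x + 1 *\<^sub>R w) = f x + G 1 *\<^sub>R w'"
      using vline wline unfolding maps_null_line_def by blast+
    then have d: "f (x + v) - f (x + w) = (F 1 * r - G 1) *\<^sub>R w'"
      by (simp add: v'w' scaleR_left_diff_distrib)
    have xvH: "x + v \<in> hyperboloid" and xwH: "x + w \<in> hyperboloid"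
      using null_line_hyperboloid[OF x v xv, of 1] null_line_hyperboloid[OF x w xw, of 1] by simp_all
    have "lorentz (f (x + v) - f (x + w)) (f (x + v) - f (x + w)) = 0"
      unfolding d using null_cone_lorentz[OF w'] by simp
    then have "f (x + v) - f (x + w) \<in> causal_cone \<or> f (x + w) - f (x + v) \<in> causal_cone"
      using lorentz_nonpos_cases[of "f (x + v) - f (x + w)"] by simp
    then have "(x + v) - (x + w) \<in> causal_cone \<or> (x + w) - (x + v) \<in> causal_cone"
      using f_causal_iff xvH xwH by blast
    then have "v - w \<in> causal_cone \<or> w - v \<in> causal_cone"
      by simp
    then have "lorentz (v - w) (v - w) \<le> 0 \<or> lorentz (w - v) (w - v) \<le> 0"
      using causal_cone_lorentz by blast
    then show False
      using vw null_cone_lorentz[OF v] null_cone_lorentz[OF w] lorentz_commute[of w v] by simp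
  qed
  then show ?thesis
    using \<kappa> by (simp add: eq_neg_iff_add_eq_0 add.commute)
qed

end

section \<open>Affine behaviour on null lines\<close>

context future_preserving
begin

text \<open>The two parameters are those at which the line has pairing 1 and - 1 with
  \<open>x\<close>. Both values are preserved by \<open>f\<close>, and subtracting the two equations
  eliminates \<open>lorentz (f x) (f z)\<close>.\<close>

lemma null_line_increment:
  assumes z: "z \<in> hyperboloid" and v: "v \<in> null_cone" and zv: "lorentz z v = 0"
    and line: "maps_null_line z v v' K" and x: "x \<in> hyperboloid" and xv: "lorentz x v < 0"
  shows "(K ((1 - lorentz x z) / lorentz x v) - K ((- 1 - lorentz x z) / lorentz x v))
    * lorentz (f x) v' = 2"
proof -
  define t s where "t = (1 - lorentz x z) / lorentz x v" and "s = (- 1 - lorentz x z) / lorentz x v"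
  define p q where "p = z + t *\<^sub>R v" and "q = z + s *\<^sub>R v"
  have p: "p \<in> hyperboloid" and q: "q \<in> hyperboloid"
    unfolding p_def q_def by (rule null_line_hyperboloid[OF z v zv])+
  have vp: "lorentz v p = 0" and vq: "lorentz v q = 0"
    using zv lorentz_commute[of v z] null_cone_lorentz[OF v] by (simp_all add: p_def q_def)
  have vx: "lorentz v x < 0"
    using xv lorentz_commute[of v x] by simp
  have xp: "lorentz x p = 1" and xq: "lorentz x q = - 1"
    using xv by (simp_all add: p_def q_def t_def s_def)
  have "x - p \<in> causal_cone"
    by (rule hyperboloid_causal_diffI[OF p x _ null_cone_causal[OF v]])
      (use xp lorentz_commute[of p x] vp vx in simp_all)
  then have fxp: "lorentz (f x) (f p) = 1"
    using f_null_iff[OF p x] xp lorentz_commute[of p x] lorentz_commute[of "f p" "f x"] by simp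
  have w0: "lorentz (x + q) (x + q) = 0"
    using lorentz_add_self[OF x q] xq by simp
  have vw: "lorentz v (x + q) < 0"
    using vx vq by simp
  \<comment> \<open>With \<open>x + q\<close> null, the antipodal case applies to \<open>x\<close>
    and \<open>q\<close> along this very direction.\<close>
  have "x + q \<in> causal_cone"
    by (rule causal_coneI[OF null_cone_causal[OF v] _ vw]) (use w0 in linarith)
  moreover have "x + q \<noteq> 0"
  proof
    assume "x + q = 0"
    then have "lorentz v (x + q) = 0"
      by (simp only: lorentz_simps)
    then show False
      using vw by simp
  qed
  ultimately have w: "x + q \<in> null_cone"
    using w0 by (simp add: null_cone_iff)
  have xw: "lorentz x (x + q) = 0" and qw: "lorentz q (x + q) = 0"
    using x q xq lorentz_commute[of q x] by (simp_all add: hyperboloid_iff)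
  obtain w' F where "maps_null_line x (x + q) w' F"
    using exists_maps_null_line[OF x w xw] .
  then have fxq: "lorentz (f x) (f q) = - 1"
    using f_null_antipodal(2)[OF x q w xw qw, of 1] by simp
  have "f p = f z + K t *\<^sub>R v'" "f q = f z + K s *\<^sub>R v'"
    using line by (simp_all add: maps_null_line_def p_def q_def)
  then have "lorentz (f x) (f z) + K t * lorentz (f x) v' = 1"
    "lorentz (f x) (f z) + K s * lorentz (f x) v' = - 1"
    using fxp fxq by simp_all
  then show ?thesis
    by (simp add: t_def s_def left_diff_distrib)
qed

text \<open>In the half-space picture given by \<^term>\<open>v\<close>, the points \<^term>\<open>x\<close> with
  \<^term>\<open>lorentz x v < 0\<close> are the balls in Euclidean space, and the null lines with direction \<^term>\<open>v\<close>
  are the families of parallel half-spaces. A ball has the same width in each direction, and so does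
  its image; comparing two orthogonal directions shows that \<^term>\<open>f\<close> acts affinely on each family.\<close>

lemma exists_null_functional:
  assumes v: "v \<in> null_cone"
  shows "\<exists>u. \<forall>x\<in>hyperboloid. lorentz (f x) u = lorentz x v"
proof -
  obtain y z w where y: "y \<in> hyperboloid" and z: "z \<in> hyperboloid"
    and yv: "lorentz y v = 0" and zv: "lorentz z v = 0" and yz: "lorentz y z = 0"
    and w: "lorentz w w = 0" "lorentz w y = 0" "lorentz w z = 0" and wv: "lorentz w v < 0"
    using exists_frame[OF card v] .
  have comm: "lorentz v y = 0" "lorentz v z = 0" "lorentz z y = 0" "lorentz y w = 0" "lorentz z w = 0"
    "lorentz v w = lorentz w v" "lorentz v v = 0" "lorentz y y = 1"
    using yv zv yz w y lorentz_commute[of v y] lorentz_commute[of v z] lorentz_commute[of z y]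
      lorentz_commute[of y w] lorentz_commute[of z w] lorentz_commute[of v w] null_cone_lorentz[OF v]
    by (simp_all add: hyperboloid_iff)
  obtain v' F where yline: "maps_null_line y v v' F"
    using exists_maps_null_line[OF y v yv] .
  obtain G where zline: "maps_null_line z v v' G"
    using parallel_null_lines[OF y z v yv zv yline] .
  have inc: "F (a + \<rho>) - F (a - \<rho>) = G \<rho> - G (- \<rho>)" if \<rho>: "0 < \<rho>" for a \<rho>
  proof -
    \<comment> \<open>The ball of radius \<open>\<rho>\<close> centred at \<open>a\<close> along
      \<open>y\<close> and at 0 along \<open>z\<close>: \<open>\<alpha>\<close> fixes the pairing
      with \<open>v\<close> as \<open>- 1 / \<rho>\<close>, and \<open>\<beta>\<close> puts
      \<open>x\<close> on the hyperboloid.\<close>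
    define \<alpha> where "\<alpha> = - 1 / (\<rho> * lorentz w v)"
    define \<beta> where "\<beta> = ((a / \<rho>)\<^sup>2 - 1) * \<rho> / 2"
    define x where "x = (a / \<rho>) *\<^sub>R y + \<alpha> *\<^sub>R w + \<beta> *\<^sub>R v"
    have \<alpha>: "\<alpha> * lorentz w v = - 1 / \<rho>"
      using wv by (simp add: \<alpha>_def)
    have xy: "lorentz x y = a / \<rho>" and xz: "lorentz x z = 0" and xv: "lorentz x v = - 1 / \<rho>"
      using \<alpha> by (simp_all add: x_def comm w yv zv yz)
    have "lorentz x x = (a / \<rho>) * lorentz x y + \<alpha> * lorentz x w + \<beta> * lorentz x v"
      unfolding x_def by (simp add: algebra_simps)
    also have "lorentz x w = \<beta> * lorentz w v"
      by (simp add: x_def comm w)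
    also have "\<alpha> * (\<beta> * lorentz w v) = \<beta> * (\<alpha> * lorentz w v)"
      by (rule mult.left_commute)
    also have "\<dots> = - \<beta> / \<rho>"
      unfolding \<alpha> by simp
    also have "(a / \<rho>) * lorentz x y + - \<beta> / \<rho> + \<beta> * lorentz x v = (a / \<rho>)\<^sup>2 - 2 * \<beta> / \<rho>"
      by (simp add: xy xv power2_eq_square)
    also have "\<dots> = 1"
      using \<rho> by (simp add: \<beta>_def)
    finally have x: "x \<in> hyperboloid"
      by (simp add: hyperboloid_iff)
    have neg: "lorentz x v < 0"
      using \<rho> by (simp add: xv)
    \<comment> \<open>The relevant parameters are \<open>a - \<rho>\<close> and
      \<open>a + \<rho>\<close> on the line through \<open>y\<close>, but \<open>- \<rho>\<close>
      and \<open>\<rho>\<close> on the line through \<open>z\<close>. The latter do not involve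
      \<open>a\<close>, so neither does the increment of \<open>F\<close>.\<close>
    have "(F (a - \<rho>) - F (a + \<rho>)) * lorentz (f x) v' = 2"
    proof -
      have "(1 - a / \<rho>) / (- 1 / \<rho>) = a - \<rho>" "(- 1 - a / \<rho>) / (- 1 / \<rho>) = a + \<rho>"
        using \<rho> by (simp_all add: field_simps)
      then show ?thesis
        using null_line_increment[OF y v yv yline x neg] unfolding xy xv by simp
    qed
    moreover have "(G (- \<rho>) - G \<rho>) * lorentz (f x) v' = 2"
      using null_line_increment[OF z v zv zline x neg] \<rho> unfolding xz xv by simp
    ultimately have "(F (a - \<rho>) - F (a + \<rho>)) * lorentz (f x) v' = (G (- \<rho>) - G \<rho>) * lorentz (f x) v'"
      and "lorentz (f x) v' \<noteq> 0"
      by auto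
    then have "F (a - \<rho>) - F (a + \<rho>) = G (- \<rho>) - G \<rho>"
      by simp
    then show ?thesis
      by linarith
  qed
  have smono: "strict_mono F"
    using yline by (simp add: maps_null_line_def)
  \<comment> \<open>The slope of \<open>F\<close> gives the vector sought,
    \<open>c *\<^sub>R v'\<close>.\<close>
  define c where "c = F 1 - F 0"
  have aff: "F t = F 0 + t * c" for t
    unfolding c_def
    by (rule affine_if_increments_translation_invariant[OF strict_mono_mono[OF smono]]) (simp add: inc)
  have neg: "lorentz (f x) (c *\<^sub>R v') = lorentz x v" if x: "x \<in> hyperboloid" and xv: "lorentz x v < 0" for x
  proof -
    have "F ((1 - lorentz x y) / lorentz x v) - F ((- 1 - lorentz x y) / lorentz x v)
        = ((1 - lorentz x y) / lorentz x v - (- 1 - lorentz x y) / lorentz x v) * c"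
      using aff[of "(1 - lorentz x y) / lorentz x v"] aff[of "(- 1 - lorentz x y) / lorentz x v"]
      by (simp only: left_diff_distrib)
    also have "\<dots> = 2 / lorentz x v * c"
      by (simp add: diff_divide_distrib[symmetric])
    finally have "2 / lorentz x v * c * lorentz (f x) v' = 2"
      using null_line_increment[OF y v yv yline x xv] by simp
    then show ?thesis
      using xv by (simp add: field_simps)
  qed
  have "lorentz (f x) (c *\<^sub>R v') = lorentz x v" if x: "x \<in> hyperboloid" for x
  proof -
    note mx = hyperboloid_uminus[OF x]
    \<comment> \<open>The positive case follows from the negative one at \<open>- x\<close>. If
      \<open>lorentz x v = 0\<close>, the sign criterion at both \<open>x\<close> and
      \<open>- x\<close> leaves only the value 0.\<close>
    consider "lorentz x v < 0" | "lorentz (- x) v < 0" | "lorentz x v = 0"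
      by fastforce
    then show ?thesis
    proof cases
      case 1
      then show ?thesis using neg x by blast
    next
      case 2
      then show ?thesis using neg[OF mx] by (simp add: f_uminus[OF x])
    next
      case 3
      then have "\<not> lorentz (f x) v' > 0" "\<not> lorentz (f (- x)) v' > 0"
        using maps_null_line_sign[OF y v yv yline] x mx by simp_all
      then have "lorentz (f x) v' = 0"
        by (simp add: f_uminus[OF x])
      then show ?thesis using 3 by simp
    qed
  qed
  then show ?thesis by blast
qed

end

section \<open>Linear extension and membership in the orthochronous group\<close>

lemma lorentz_nondegenerate:
  fixes k :: "real \<times> (real ^ 'n)"
  assumes orth: "\<And>x. x \<in> hyperboloid \<Longrightarrow> lorentz x k = 0"
  shows "k = 0"
proof -
  have "snd k = 0"
  proof (rule ccontr)
    assume n: "snd k \<noteq> 0"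
    have "(0, snd k /\<^sub>R norm (snd k)) \<in> hyperboloid"
      using n by (simp add: hyperboloid_iff lorentz_self)
    from orth[OF this] show False
      using n by (simp add: lorentz_eq)
  qed
  obtain e :: "real ^ 'n" where e: "norm e = 1"
    using vector_choose_size[of 1] by auto
  have "(1, sqrt 2 *\<^sub>R e) \<in> hyperboloid"
    using e by (simp add: hyperboloid_iff lorentz_self)
  from orth[OF this] have "fst k = 0"
    using \<open>snd k = 0\<close> by (simp add: lorentz_eq)
  with \<open>snd k = 0\<close> show ?thesis
    by (simp add: prod_eq_iff)
qed

text \<open>The null vectors are \<open>(1, e)\<close> and \<open>(1, - e)\<close> with
  \<open>e\<close> a unit vector along \<open>snd w\<close>. Both coefficients are nonnegative
  exactly when \<open>w\<close> is causal, so null vectors span the space and positively generate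
  the causal cone.\<close>

lemma causal_cone_decomposition:
  fixes w :: "real \<times> (real ^ 'n)"
  obtains u v where "u \<in> null_cone" "v \<in> null_cone"
    "w = ((fst w + norm (snd w)) / 2) *\<^sub>R u + ((fst w - norm (snd w)) / 2) *\<^sub>R v"
proof -
  obtain e :: "real ^ 'n" where e: "norm e = 1" "snd w = norm (snd w) *\<^sub>R e"
  proof (cases "snd w = 0")
    case True
    then show thesis
      using that vector_choose_size[of 1] by auto
  next
    case False
    then show thesis
      using that[of "snd w /\<^sub>R norm (snd w)"] by simp
  qed
  define a b where "a = fst w" and "b = norm (snd w)"
  have "((a + b) / 2) *\<^sub>R e + ((a - b) / 2) *\<^sub>R (- e) = ((a + b) / 2 - (a - b) / 2) *\<^sub>R e"
    by (simp only: scaleR_left_diff_distrib scaleR_minus_right add_uminus_conv_diff)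
  also have "(a + b) / 2 - (a - b) / 2 = b"
    by (simp add: diff_divide_distrib[symmetric])
  finally have "snd w = ((a + b) / 2) *\<^sub>R e + ((a - b) / 2) *\<^sub>R (- e)"
    using e(2) by (simp add: b_def)
  moreover have "fst w = (a + b) / 2 + (a - b) / 2"
    by (simp add: a_def add_divide_distrib[symmetric])
  ultimately have "w = ((a + b) / 2) *\<^sub>R (1, e) + ((a - b) / 2) *\<^sub>R (1, - e)"
    by (simp only: prod_eq_iff fst_add snd_add fst_scaleR snd_scaleR fst_conv snd_conv) simp
  then show thesis
    using e(1) unfolding a_def b_def by (intro that[of "(1, e)" "(1, - e)"]) (simp_all add: null_cone_def)
qed

lemma span_null_cone: "span (null_cone :: (real \<times> (real ^ 'n)) set) = UNIV"
proof -
  have "w \<in> span null_cone" for w :: "real \<times> (real ^ 'n)"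
  proof -
    obtain u v where "u \<in> null_cone" "v \<in> null_cone"
      "w = ((fst w + norm (snd w)) / 2) *\<^sub>R u + ((fst w - norm (snd w)) / 2) *\<^sub>R v"
      by (rule causal_cone_decomposition)
    then show ?thesis
      by (metis span_add span_base span_scale)
  qed
  then show ?thesis by blast
qed

lemma forward_cone_iff: "w \<in> forward_cone \<longleftrightarrow> w \<in> causal_cone \<and> lorentz w w < 0"
proof -
  have "(\<Sum>i\<in>UNIV. (snd w $ i)\<^sup>2) = (norm (snd w))\<^sup>2"
    unfolding power2_norm_eq_inner inner_vec_def by (simp add: power2_eq_square)
  then have "w \<in> forward_cone \<longleftrightarrow> (norm (snd w))\<^sup>2 < (fst w)\<^sup>2 \<and> 0 < fst w"
    by (simp add: forward_cone_def)
  also have "\<dots> \<longleftrightarrow> norm (snd w) \<le> fst w \<and> (norm (snd w))\<^sup>2 < (fst w)\<^sup>2"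
  proof
    assume "(norm (snd w))\<^sup>2 < (fst w)\<^sup>2 \<and> 0 < fst w"
    then show "norm (snd w) \<le> fst w \<and> (norm (snd w))\<^sup>2 < (fst w)\<^sup>2"
      using power2_less_imp_less[of "norm (snd w)" "fst w"] by simp
  next
    assume a: "norm (snd w) \<le> fst w \<and> (norm (snd w))\<^sup>2 < (fst w)\<^sup>2"
    then have "0 \<le> fst w"
      using order_trans[OF norm_ge_zero] by blast
    moreover have "fst w \<noteq> 0"
      using a by auto
    ultimately show "(norm (snd w))\<^sup>2 < (fst w)\<^sup>2 \<and> 0 < fst w"
      using a by simp
  qed
  finally show ?thesis
    by (simp add: causal_cone_def lorentz_self)
qed

text \<open>Scaling to the hyperboloid settles spacelike vectors. A general \<open>z\<close> is
  reached by the parallelogram law from the spacelike vectors \<open>z + t *\<^sub>R s\<close>,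
  \<open>z - t *\<^sub>R s\<close> and \<open>s\<close>.\<close>

lemma linear_preserves_lorentz:
  fixes g :: "real \<times> (real ^ 'n) \<Rightarrow> real \<times> (real ^ 'n)"
  assumes g: "linear g" and H: "\<And>x. x \<in> hyperboloid \<Longrightarrow> g x \<in> hyperboloid"
  shows "lorentz (g z) (g z) = lorentz z z"
proof -
  have spacelike: "lorentz (g z) (g z) = lorentz z z" if pos: "lorentz z z > 0" for z
  proof -
    define r where "r = sqrt (lorentz z z)"
    have r: "r > 0" "r * r = lorentz z z"
      using pos by (simp_all add: r_def)
    have "z /\<^sub>R r \<in> hyperboloid"
      using r pos by (simp add: hyperboloid_iff field_simps flip: r(2))
    then have "g (z /\<^sub>R r) \<in> hyperboloid"
      by (rule H)
    then have "lorentz (g z) (g z) / (r * r) = 1"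
      by (simp add: hyperboloid_iff linear_cmul[OF g] divide_inverse mult.commute mult.left_commute)
    then show ?thesis
      using r pos by simp
  qed
  obtain e :: "real ^ 'n" where "norm e = 1"
    using vector_choose_size[of 1] by auto
  then have s: "lorentz (0, e) (0, e) = 1"
    by (simp add: lorentz_self)
  define s :: "real \<times> (real ^ 'n)" where "s = (0, e)"
  have ss: "lorentz s s = 1" "lorentz s z = lorentz z s"
    using s lorentz_commute[of s z] by (simp_all add: s_def)
  \<comment> \<open>Large enough for \<open>t * t\<close> to outweigh the other terms of both
    Lorentz squares.\<close>
  define t where "t = 1 + \<bar>lorentz z z\<bar> + 2 * \<bar>lorentz z s\<bar>"
  have t: "t \<ge> 1"
    by (simp add: t_def)
  have "\<bar>lorentz z z\<bar> * 1 \<le> \<bar>lorentz z z\<bar> * t"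
    by (rule mult_left_mono[OF t]) simp
  then have "\<bar>lorentz z z\<bar> + 2 * (\<bar>lorentz z s\<bar> * t) < t * t"
    using t by (subst (2) t_def) (simp add: distrib_right)
  moreover have "\<bar>lorentz z s * t\<bar> = \<bar>lorentz z s\<bar> * t"
    using t by (simp add: abs_mult)
  ultimately have pos: "lorentz z z + 2 * (lorentz z s * t) + t * t > 0"
    "lorentz z z - 2 * (lorentz z s * t) + t * t > 0"
    by linarith+
  have plus: "lorentz (z + t *\<^sub>R s) (z + t *\<^sub>R s) = lorentz z z + 2 * (lorentz z s * t) + t * t"
    and minus: "lorentz (z - t *\<^sub>R s) (z - t *\<^sub>R s) = lorentz z z - 2 * (lorentz z s * t) + t * t"
    using ss by (simp_all add: algebra_simps)
  have "lorentz (g (z + t *\<^sub>R s)) (g (z + t *\<^sub>R s)) + lorentz (g (z - t *\<^sub>R s)) (g (z - t *\<^sub>R s))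
      = 2 * lorentz (g z) (g z) + 2 * (t * t) * lorentz (g s) (g s)"
    by (simp add: linear_add[OF g] linear_diff[OF g] linear_cmul[OF g] algebra_simps)
  moreover have "lorentz (g (z + t *\<^sub>R s)) (g (z + t *\<^sub>R s)) = lorentz (z + t *\<^sub>R s) (z + t *\<^sub>R s)"
    "lorentz (g (z - t *\<^sub>R s)) (g (z - t *\<^sub>R s)) = lorentz (z - t *\<^sub>R s) (z - t *\<^sub>R s)"
    "lorentz (g s) (g s) = 1"
  proof -
    show "lorentz (g (z + t *\<^sub>R s)) (g (z + t *\<^sub>R s)) = lorentz (z + t *\<^sub>R s) (z + t *\<^sub>R s)"
      by (rule spacelike) (unfold plus, rule pos)
    show "lorentz (g (z - t *\<^sub>R s)) (g (z - t *\<^sub>R s)) = lorentz (z - t *\<^sub>R s) (z - t *\<^sub>R s)"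
      by (rule spacelike) (unfold minus, rule pos)
    show "lorentz (g s) (g s) = 1"
      using spacelike[of s] ss by simp
  qed
  ultimately show ?thesis
    unfolding plus minus by simp
qed

text \<open>Positivity on null vectors passes to the causal cone by decomposition. Nondegeneracy
  makes \<open>g\<close> bijective, and a preimage of a forward vector is timelike and cannot point
  backward.\<close>

lemma orthochronousI:
  fixes g :: "real \<times> (real ^ 'n) \<Rightarrow> real \<times> (real ^ 'n)"
  assumes g: "linear g" and iso: "\<And>x. lorentz (g x) (g x) = lorentz x x"
    and null: "\<And>v. v \<in> null_cone \<Longrightarrow> g v \<in> causal_cone"
  shows "g \<in> orthochronous_group"
proof -
  have polar: "lorentz (g x) (g y) = lorentz x y" for x y
    using iso[of "x + y"] iso[of x] iso[of y] lorentz_commute[of y x] lorentz_commute[of "g y" "g x"]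
    by (simp add: linear_add[OF g])
  have "k = 0" if "g k = 0" for k
    using lorentz_nondegenerate[of k] polar[of _ k] that by simp
  then have "inj g"
    using linear_injective_0[OF g] by blast
  then have "surj g"
    by (rule linear_inj_imp_surj[OF g])
  have causal: "g w \<in> causal_cone" if "w \<in> causal_cone" for w
  proof -
    obtain u v where uv: "u \<in> null_cone" "v \<in> null_cone"
      "w = ((fst w + norm (snd w)) / 2) *\<^sub>R u + ((fst w - norm (snd w)) / 2) *\<^sub>R v"
      by (rule causal_cone_decomposition)
    have "norm (snd w) \<le> fst w"
      using that by (simp add: causal_cone_def)
    then have "0 \<le> fst w + norm (snd w)" "0 \<le> fst w - norm (snd w)"
      using norm_ge_zero[of "snd w"] by linarith+
    then show ?thesis
      by (subst uv(3)) (simp add: linear_add[OF g] linear_cmul[OF g] causal_cone_add causal_cone_scaleR null uv(1,2))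
  qed
  have "g ` forward_cone = forward_cone"
  proof (intro equalityI subsetI)
    fix w :: "real \<times> (real ^ 'n)" assume "w \<in> g ` forward_cone"
    then show "w \<in> forward_cone"
      by (auto simp: forward_cone_iff causal iso)
  next
    fix w :: "real \<times> (real ^ 'n)" assume w: "w \<in> forward_cone"
    obtain u where u: "w = g u"
      using \<open>surj g\<close> by (metis surjD)
    have neg: "lorentz u u < 0"
      using w by (simp add: u forward_cone_iff iso)
    have "- u \<notin> causal_cone"
    proof
      assume "- u \<in> causal_cone"
      then have "- w \<in> causal_cone"
        using causal[of "- u"] by (simp add: u linear_neg[OF g])
      then have "w = 0"
        using w causal_cone_antisym[of w] by (simp add: forward_cone_iff)
      then show False
        using w by (simp add: forward_cone_iff)
    qed
    then have "u \<in> forward_cone"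
      using lorentz_nonpos_cases[of u] neg by (simp add: forward_cone_iff)
    then show "w \<in> g ` forward_cone"
      using u by blast
  qed
  then show ?thesis
    unfolding orthochronous_group_def using g iso by blast
qed

text \<open>If pairing with suitable vectors \<^term>\<open>u\<close> turns \<^term>\<open>f\<close> into all the functionals
  \<^term>\<open>\<lambda>x. lorentz x v\<close>, then \<^term>\<open>f\<close> is the inverse transpose of the linear extension of \<open>v \<mapsto> u\<close>.\<close>

lemma linear_extension_from_null_functionals:
  fixes f :: "real \<times> (real ^ 'n) \<Rightarrow> real \<times> (real ^ 'n)"
  assumes "\<And>v. v \<in> null_cone \<Longrightarrow> \<exists>u. \<forall>x\<in>hyperboloid. lorentz (f x) u = lorentz x v"
  obtains g where "linear g" "\<And>x. x \<in> hyperboloid \<Longrightarrow> g x = f x"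
proof -
  obtain U where U: "\<And>v x. v \<in> null_cone \<Longrightarrow> x \<in> hyperboloid \<Longrightarrow> lorentz (f x) (U v) = lorentz x v"
    using assms by metis
  \<comment> \<open>\<open>U\<close> is an arbitrary choice, so it is kept only on a basis of null
    vectors and extended linearly from there.\<close>
  obtain B :: "(real \<times> (real ^ 'n)) set" where B: "B \<subseteq> null_cone" "independent B" "null_cone \<subseteq> span B"
    using maximal_independent_subset[of null_cone] by blast
  have span: "span B = UNIV"
    using span_mono[OF B(3)] by (simp add: span_null_cone span_span top.extremum_unique)
  obtain T where T: "linear T" "\<And>b. b \<in> B \<Longrightarrow> T b = U b"
    using linear_independent_extend[OF B(2)] by blast
  have dual: "lorentz (f x) (T k) = lorentz x k" if x: "x \<in> hyperboloid" for x k
  proof -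
    have "linear (\<lambda>k. lorentz (f x) (T k))" "linear (\<lambda>k. lorentz x k)"
      by (rule linearI; simp only: lorentz_simps linear_add[OF T(1)] linear_cmul[OF T(1)] real_scaleR_def)+
    moreover have "k \<in> span B"
      by (simp add: span)
    moreover have "lorentz (f x) (T b) = lorentz x b" if "b \<in> B" for b
      using U[OF subsetD[OF B(1) that] x] T(2)[OF that] by simp
    ultimately show ?thesis
      by (rule linear_eq_on)
  qed
  have "k = 0" if "T k = 0" for k
    by (rule lorentz_nondegenerate) (use dual[of _ k] that in simp)
  then have "inj T"
    using linear_injective_0[OF T(1)] by blast
  then have "surj T"
    by (rule linear_inj_imp_surj[OF T(1)])
  then obtain S where S: "linear S" "\<And>z. T (S z) = z"
    using linear_surjective_right_inverse[OF T(1)] by (metis comp_apply id_apply)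
  \<comment> \<open>\<open>J\<close> converts the Lorentz form into the inner product, so that
    conjugating the Euclidean adjoint by \<open>J\<close> gives the Lorentz adjoint of
    \<open>S\<close>.\<close>
  define J :: "real \<times> (real ^ 'n) \<Rightarrow> real \<times> (real ^ 'n)" where "J x = (- fst x, snd x)" for x
  have J: "linear J" "J (J x) = x" "J x \<bullet> z = lorentz x z" for x z
    by (auto intro!: linearI simp: J_def lorentz_eq inner_prod_def)
  have "J (adjoint S (J x)) = f x" if x: "x \<in> hyperboloid" for x
  proof -
    have "z \<bullet> adjoint S (J x) = z \<bullet> J (f x)" for z
    proof -
      have "z \<bullet> adjoint S (J x) = J x \<bullet> S z"
        by (simp add: adjoint_works[OF S(1)] inner_commute)
      also have "\<dots> = lorentz (f x) (T (S z))"
        unfolding J(3) dual[OF x] ..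
      also have "\<dots> = z \<bullet> J (f x)"
        by (simp add: S(2) inner_commute[of z] J(3))
      finally show ?thesis .
    qed
    then have "adjoint S (J x) = J (f x)"
      using vector_eq_ldot by blast
    then show ?thesis
      by (simp add: J(2))
  qed
  moreover have "linear (\<lambda>x. J (adjoint S (J x)))"
    using linear_compose[OF linear_compose[OF J(1) adjoint_linear[OF S(1)]] J(1)] by (simp add: o_def)
  ultimately show thesis
    using that by blast
qed

theorem corollary13:
  fixes f :: "real \<times> (real ^ 'n) \<Rightarrow> real \<times> (real ^ 'n)"
  assumes "CARD('n) \<ge> 3"
    and "f \<in> hyperboloid \<rightarrow> hyperboloid"
    and "inj_on f hyperboloid"
    and "\<And>x. x \<in> hyperboloid \<Longrightarrow> f ` future x = future (f x)"
  shows "\<exists>g \<in> orthochronous_group. \<forall>x \<in> hyperboloid. f x = g x"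
proof -
  interpret future_preserving f
    by unfold_locales (use assms in auto)
  obtain g where g: "linear g" and gf: "\<And>x. x \<in> hyperboloid \<Longrightarrow> g x = f x"
    using linear_extension_from_null_functionals[OF exists_null_functional] by blast
  have "g v \<in> causal_cone" if v: "v \<in> null_cone" for v
  proof -
    \<comment> \<open>The vector \<open>v\<close> is realised as the difference of the comparable
      points \<open>y\<close> and \<open>y + v\<close>, so the order determines the time orientation
      of \<open>g v\<close>.\<close>
    obtain y where y: "y \<in> hyperboloid" "lorentz y v = 0"
      by (rule exists_frame[OF card v])
    have yv: "y + v \<in> hyperboloid"
      using null_line_hyperboloid[OF y(1) v y(2), of 1] by simp
    have "f (y + v) - f y \<in> causal_cone"
      using f_causal_iff[OF y(1) yv] null_cone_causal[OF v] by simp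
    moreover have "f (y + v) - f y = g v"
      using linear_add[OF g, of y v] unfolding gf[OF y(1)] gf[OF yv] by simp
    ultimately show ?thesis by simp
  qed
  moreover have "lorentz (g x) (g x) = lorentz x x" for x
    by (rule linear_preserves_lorentz[OF g]) (simp add: gf f_hyperboloid)
  ultimately have "g \<in> orthochronous_group"
    using orthochronousI[OF g] by blast
  then show ?thesis
    by (intro bexI[of _ g]) (simp_all add: gf)
qed

end
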